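(* Let $m\ge 0$ and $n\ge 1$ be integers with $n\le 2m+1$, and put $p=\frac{2(m+1)}{2m+1-n}$ (with $p=\infty$ and $1/p=0$ if $n=2m+1$). Let ${\rm K}_{n,p}$ be the sharp (smallest possible) constant in the inequality $$|f^{(n)}(z)|\le \frac{{\rm K}_{n,p}}{(\Im z)^{n+\frac1p}}\,\|\Re f\|_p ,$$ valid for all analytic functions $f$ in $\mathbb{C}_+$ with $\Re f\in h^p(\mathbb{R}^2_+)$ and all points $z\in\mathbb{C}_+$. Then $${\rm K}_{n,p}=\frac{n!}{\pi}\left\{\int_{-\pi/2}^{\pi/2}\big|\cos (n+1)\varphi\big|^{\frac{2(m+1)}{n+1}}\cos^{2m}\varphi\,d\varphi\right\}^{\frac{n+1}{2(m+1)}}$$ $$=\frac{n!}{\pi}\left\{\frac{(2m-1)!!}{(2m)!!}\,B\!\left(\frac{m+1}{n+1}+\frac12,\frac12\right)+\frac{\pi(n+1)}{2^{2m-1+\frac{2(m+1)}{n+1}}(2m+n+3)}\sum_{j=1}^{\left[\frac{m}{n+1}\right]}\frac{\binom{2m}{m-j(n+1)}}{B\!\left(\frac{m+1}{n+1}+j+1,\frac{m+1}{n+1}-j+1\right)}\right\}^{\frac{n+1}{2(m+1)}} .$$ In particular, for $m\le n$, $${\rm K}_{n,p}=\frac{n!}{\pi}\left\{\frac{(2m-1)!!}{(2m)!!}\,B\!\left(\frac{m+1}{n+1}+\frac12,\frac12\right)\right\}^{\frac{n+1}{2(m+1)}} .$$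
   Context: $\mathbb{C}_+=\{z\in\mathbb{C}:\Im z>0\}$, identified with $\mathbb{R}^2_+$. For $1\le p\le\infty$, $h^p(\mathbb{R}^2_+)$ is the space of harmonic functions in the upper half-plane of the form $u(x+iy)=\frac{1}{\pi}\int_{-\infty}^{\infty}\frac{y\,g(t)}{(x-t)^2+y^2}\,dt$ with real $g\in L^p(-\infty,\infty)$. For $f$ analytic in $\mathbb{C}_+$ with $\Re f\in h^p(\mathbb{R}^2_+)$, $\|\Re f\|_p$ denotes the $L^p(-\infty,\infty)$ norm of the boundary values $g$ of $\Re f$ on $\partial\mathbb{C}_+=\mathbb{R}$. $B$ is the Beta function, $[a]$ is the integer part of $a$, $k!!$ is the double factorial with $(-1)!!=0!!=1$, and empty sums are zero. *)

theory Defs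
  imports
    "HOL-Complex_Analysis.Complex_Analysis"
    "HOL-Probability.Essential_Supremum"
begin

definition upper_half_plane :: "complex set" where
  "upper_half_plane = {z. 0 < Im z}"

definition Lp_fun :: "ereal \<Rightarrow> (real \<Rightarrow> real) \<Rightarrow> bool" where
  "Lp_fun p g \<longleftrightarrow> g \<in> borel_measurable lebesgue \<and>
     (if p = \<infinity> then esssup lebesgue (\<lambda>t. ereal \<bar>g t\<bar>) < \<infinity>
      else integrable lebesgue (\<lambda>t. \<bar>g t\<bar> powr real_of_ereal p))"

definition Lp_norm :: "ereal \<Rightarrow> (real \<Rightarrow> real) \<Rightarrow> real" where
  "Lp_norm p g =
     (if p = \<infinity> then real_of_ereal (esssup lebesgue (\<lambda>t. ereal \<bar>g t\<bar>))
      else (LINT t|lebesgue. \<bar>g t\<bar> powr real_of_ereal p) powr (1 / real_of_ereal p))"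

text \<open>
  The function \<open>u\<close> belongs to the class \<open>h\<^sup>p\<close> of the upper half-plane, with boundary values
  \<open>g\<close>. Membership of \<open>u\<close> in \<open>h\<^sup>p\<close> means that such a \<open>g\<close> exists; it is then determined
  almost everywhere, so \<open>Lp_norm p g\<close> depends on \<open>u\<close> only.
\<close>

definition hp_with_boundary :: "ereal \<Rightarrow> (complex \<Rightarrow> real) \<Rightarrow> (real \<Rightarrow> real) \<Rightarrow> bool" where
  "hp_with_boundary p u g \<longleftrightarrow> Lp_fun p g \<and>
     (\<forall>x y. 0 < y \<longrightarrow>
        u (Complex x y) = 1 / pi * (LINT t|lebesgue. y * g t / ((x - t)\<^sup>2 + y\<^sup>2)))"

definition admissible_constant :: "nat \<Rightarrow> ereal \<Rightarrow> real \<Rightarrow> bool" where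
  "admissible_constant n p C \<longleftrightarrow>
     (\<forall>f g. f analytic_on upper_half_plane \<longrightarrow> hp_with_boundary p (\<lambda>z. Re (f z)) g \<longrightarrow>
        (\<forall>z\<in>upper_half_plane.
           cmod ((deriv ^^ n) f z) \<le> C / Im z powr (real n + real_of_ereal (1 / p)) * Lp_norm p g))"

definition sharp_constant :: "nat \<Rightarrow> ereal \<Rightarrow> real \<Rightarrow> bool" where
  "sharp_constant n p K \<longleftrightarrow>
     admissible_constant n p K \<and> (\<forall>C. admissible_constant n p C \<longrightarrow> K \<le> C)"

text \<open>
  The convention \<open>(-1)!! = 1\<close> agrees with \<open>0!! = 1\<close> under truncated subtraction, so
  \<open>double_fact (2 * m - 1)\<close> is correct also for \<open>m = 0\<close>.
\<close>

fun double_fact :: "nat \<Rightarrow> nat" where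
  "double_fact 0 = 1"
| "double_fact (Suc 0) = 1"
| "double_fact (Suc (Suc k)) = Suc (Suc k) * double_fact k"

end

(*
  Since Re (i/(z-t)) is the Poisson kernel, f(z) - f(z0) is (i/pi) times the integral of
  g(t) (1/(z-t) - 1/(z0-t)); this kernel is O(1/t^2), so the integral converges for every g in L^p.
  Expanding it in powers of z - z0 gives |f^(n)(z)| = n!/pi |int g(t) (z-t)^(-n-1) dt|.
  With q = 2(m+1)/(n+1), the exponent conjugate to p, the sharp constant is therefore n!/pi times the
  supremum over unimodular c of the L^q norm of Re (c (z-t)^(-n-1)).  The substitution
  t = x + y tan phi turns the q-th power of this norm into the integral of
  |cos((n+1) phi + alpha)|^q cos^(2m) phi.  Expanding cos^(2m) into cosines, only the frequencies
  divisible by n+1 survive, and the integral becomes a finite sum of terms C_j cos(2 j alpha).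
  The Fourier coefficient of |cos|^q of index j is positive as long as j < q/2 + 1, which holds for all
  j <= m/(n+1); hence every C_j is positive, alpha = 0 is optimal, and the sum at alpha = 0 is the
  closed form.
*)

theory Submission
  imports Defs
begin

section \<open>Power series of Cauchy integrals\<close>

text \<open>The difference of two Cauchy kernels is forced by the endpoint
  \<open>p = \<infinity>\<close>: there \<open>1 / (z - t)\<close> need not be integrable against a
  bounded \<open>g\<close>. The price is an unknown constant, which disappears on differentiating
  because \<open>n \<ge> 1\<close>; so does the imaginary constant that \<open>Re f\<close> leaves
  undetermined. The exponent is tuned to the order of the derivative. With \<open>N = n + 1\<close>
  the conjugate exponent satisfies \<open>N * q = 2 * (m + 1)\<close>, so the \<open>q\<close>-th
  power of the kernel contributes \<open>cos \<phi> ^ (2 * m + 2)\<close>, the Jacobian removes two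
  factors, and an even integer power remains. That power is a trigonometric polynomial, hence the
  sums are finite. The condition \<open>n \<le> 2 * m + 1\<close> says \<open>q \<ge> 1\<close>. The
  same relation yields the positivity range: \<open>j * N \<le> m < m + 1 = N * q / 2\<close>. Since
  \<open>g\<close> is real, the modulus of the Cauchy integral is reached only after a rotation. For
  each phase \<open>\<alpha>\<close> duality is sharp, and what has to be proved is that one phase
  is best.\<close>

lemma higher_deriv_eq_coeff:
  assumes r: "0 < r" and sums: "\<And>w. w \<in> ball z r \<Longrightarrow> (\<lambda>k. a k * (w - z) ^ k) sums f w"
  shows "(deriv ^^ n) f z = fact n * (a n :: complex)"
proof -
  have conv: "fps_conv_radius (Abs_fps a) \<ge> r"
    unfolding fps_conv_radius_def
  proof (rule conv_radius_geI_ex')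
    fix s :: real assume s: "0 < s" "ereal s < ereal r"
    have "(\<lambda>k. a k * of_real s ^ k) sums f (z + of_real s)"
      using sums[of "z + of_real s"] s by (simp add: dist_norm)
    then show "summable (\<lambda>k. fps_nth (Abs_fps a) k * of_real s ^ k)"
      by (auto dest: sums_summable)
  qed
  have ev: "\<forall>\<^sub>F w in nhds 0. w \<in> ball (0::complex) r"
    using r by (intro eventually_nhds_in_open) auto
  have "(\<lambda>w. f (z + w)) has_fps_expansion Abs_fps a"
    unfolding has_fps_expansion_def
  proof
    show "0 < fps_conv_radius (Abs_fps a)"
      using conv r by (metis ereal_less(2) less_le_trans)
    show "\<forall>\<^sub>F w in nhds 0. eval_fps (Abs_fps a) w = f (z + w)"
      using ev
    proof eventually_elim
      case (elim w)
      then have "(\<lambda>k. a k * w ^ k) sums f (z + w)"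
        using sums[of "z + w"] by (simp add: dist_norm)
      then show ?case
        by (simp add: eval_fps_def sums_iff)
    qed
  qed
  from fps_nth_fps_expansion[OF this, of n] show ?thesis
    by (simp add: higher_deriv_shift_0' comp_def field_simps)
qed

text \<open>By the open mapping theorem the image under a nonconstant \<open>h\<close> contains a
  disc, hence points with different real parts.\<close>

lemma holomorphic_Re_const_imp_constant_on:
  assumes "h holomorphic_on S" "open S" "connected S" "\<And>w. w \<in> S \<Longrightarrow> Re (h w) = c"
  shows "h constant_on S"
proof (rule ccontr)
  assume nc: "\<not> h constant_on S"
  then have "S \<noteq> {}" by (auto simp: constant_on_def)
  then obtain w where w: "w \<in> S" by blast
  have "open (h ` S)"
    by (rule open_mapping_thm[OF assms(1,2,3) assms(2) subset_refl nc])
  then obtain e where e: "e > 0" "ball (h w) e \<subseteq> h ` S"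
    using w by (meson openE image_eqI)
  have "h w + of_real (e / 2) \<in> ball (h w) e"
    using e(1) by (simp add: dist_norm)
  then obtain v where "v \<in> S" "h v = h w + of_real (e / 2)"
    using e(2) by fastforce
  then show False
    using assms(4)[of v] assms(4)[OF w] e(1) by simp
qed

lemma Im_le_cmod_diff_of_real: "Im z \<le> cmod (z - of_real t)"
  using abs_Im_le_cmod[of "z - of_real t"] by simp

lemma borel_measurable_lebesgue_of_continuous:
  fixes f :: "real \<Rightarrow> 'b::{second_countable_topology, topological_space}"
  assumes "continuous_on UNIV f"
  shows "f \<in> borel_measurable lebesgue"
  using borel_measurable_continuous_onI[OF assms] by (simp add: measurable_completion)

text \<open>Geometric series in \<open>x = - (z - z0) / (z0 - s)\<close>. Subtracting the value at
  \<open>z0\<close> removes the term of order zero, so every remaining term has at least two factors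
  \<open>z0 - s\<close> in its denominator.\<close>

lemma sums_inverse_diff:
  fixes z0 z s :: complex
  assumes "cmod (z - z0) < cmod (z0 - s)"
  shows "(\<lambda>k. (-1) ^ Suc k * (z - z0) ^ Suc k / (z0 - s) ^ Suc (Suc k))
           sums (1 / (z - s) - 1 / (z0 - s))"
proof -
  define x where "x = - (z - z0) / (z0 - s)"
  have ne: "z0 - s \<noteq> 0" using assms by auto
  have ne': "z - s \<noteq> 0" using assms by (auto simp: norm_minus_commute)
  have "cmod x < 1"
    using assms ne by (simp add: x_def norm_divide norm_minus_commute)
  then have "(\<lambda>k. x ^ k) sums (1 / (1 - x))"
    by (rule geometric_sums)
  then have "(\<lambda>k. x / (z0 - s) * x ^ k) sums (x / (z0 - s) * (1 / (1 - x)))"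
    by (rule sums_mult)
  moreover have "x / (z0 - s) * (1 / (1 - x)) = 1 / (z - s) - 1 / (z0 - s)"
  proof -
    have "1 - x = (z - s) / (z0 - s)"
      using ne by (simp add: x_def field_simps)
    then show ?thesis
      using ne ne' by (simp add: x_def divide_simps)
  qed
  moreover have "x / (z0 - s) * x ^ k = (-1) ^ Suc k * (z - z0) ^ Suc k / (z0 - s) ^ Suc (Suc k)" for k
  proof -
    have "x / (z0 - s) * x ^ k = x ^ Suc k / (z0 - s)" by simp
    also have "x ^ Suc k = (-1) ^ Suc k * (z - z0) ^ Suc k / (z0 - s) ^ Suc k"
      unfolding x_def by (simp only: power_divide power_minus[of "z - z0"])
    finally show ?thesis by (simp add: field_simps)
  qed
  ultimately show ?thesis by simp
qed

text \<open>Integrability against the Poisson kernel controls all higher powers, since each further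
  factor costs at most \<open>1 / Im z\<close>. The norm bound is geometric in \<open>k\<close>,
  ready for summation.\<close>

lemma integrable_over_power:
  fixes g :: "real \<Rightarrow> real"
  assumes g: "g \<in> borel_measurable lebesgue" and z: "0 < Im z"
    and int: "integrable lebesgue (\<lambda>t. g t / (cmod (z - of_real t))\<^sup>2)"
  shows "integrable lebesgue (\<lambda>t. of_real (g t) / (z - of_real t) ^ (k + 2))"
    and "LINT t|lebesgue. cmod (of_real (g t) / (z - of_real t) ^ (k + 2))
           \<le> (LINT t|lebesgue. \<bar>g t\<bar> / (cmod (z - of_real t))\<^sup>2) / Im z ^ k"
proof -
  have ne: "z - of_real t \<noteq> 0" for t using z by (metis Im_complex_of_real less_irrefl right_minus_eq)
  have int': "integrable lebesgue (\<lambda>t. \<bar>g t\<bar> / (cmod (z - of_real t))\<^sup>2 / Im z ^ k)"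
    using integrable_abs[OF int] by (intro integrable_divide) (simp add: abs_divide)
  have meas: "(\<lambda>t. of_real (g t) / (z - of_real t) ^ (k + 2)) \<in> borel_measurable lebesgue"
  proof -
    have [measurable]: "(\<lambda>t. 1 / (z - of_real t) ^ (k + 2)) \<in> borel_measurable lebesgue"
      using ne by (intro borel_measurable_lebesgue_of_continuous continuous_intros) auto
    have [measurable]: "(\<lambda>t. complex_of_real (g t)) \<in> borel_measurable lebesgue"
      using g by measurable
    have "(\<lambda>t. of_real (g t) * (1 / (z - of_real t) ^ (k + 2))) \<in> borel_measurable lebesgue"
      by measurable
    then show ?thesis by simp
  qed
  have le: "cmod (of_real (g t) / (z - of_real t) ^ (k + 2)) \<le> \<bar>g t\<bar> / (cmod (z - of_real t))\<^sup>2 / Im z ^ k" for t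
  proof -
    have "Im z ^ k \<le> cmod (z - of_real t) ^ k"
      using z Im_le_cmod_diff_of_real by (intro power_mono) auto
    then have "\<bar>g t\<bar> / (cmod (z - of_real t))\<^sup>2 / cmod (z - of_real t) ^ k \<le> \<bar>g t\<bar> / (cmod (z - of_real t))\<^sup>2 / Im z ^ k"
      using z ne[of t] by (intro divide_left_mono mult_pos_pos) auto
    then show ?thesis
      by (simp add: norm_divide norm_power norm_mult power_add mult_ac power2_eq_square)
  qed
  show 1: "integrable lebesgue (\<lambda>t. of_real (g t) / (z - of_real t) ^ (k + 2))"
    by (rule Bochner_Integration.integrable_bound[OF int' meas]) (intro AE_I2 order_trans[OF le], simp add: z less_imp_le)
  have "LINT t|lebesgue. cmod (of_real (g t) / (z - of_real t) ^ (k + 2))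
      \<le> (LINT t|lebesgue. \<bar>g t\<bar> / (cmod (z - of_real t))\<^sup>2 / Im z ^ k)"
    by (rule integral_mono[OF integrable_norm[OF 1] int' le])
  also have "\<dots> = (LINT t|lebesgue. \<bar>g t\<bar> / (cmod (z - of_real t))\<^sup>2) / Im z ^ k"
    by (rule integral_divide_zero)
  finally show "LINT t|lebesgue. cmod (of_real (g t) / (z - of_real t) ^ (k + 2))
      \<le> (LINT t|lebesgue. \<bar>g t\<bar> / (cmod (z - of_real t))\<^sup>2) / Im z ^ k" .
qed

definition cauchy_diff :: "(real \<Rightarrow> real) \<Rightarrow> complex \<Rightarrow> complex \<Rightarrow> complex" where
  "cauchy_diff g z0 z =
     (LINT t|lebesgue. of_real (g t) * (1 / (z - of_real t) - 1 / (z0 - of_real t)))"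

text \<open>Sum and integral may be exchanged because the L1 norms of the terms are dominated by a
  geometric series of ratio \<open>cmod (z - z0) / Im z0\<close>; the radius \<open>Im z0\<close> is
  the distance from \<open>z0\<close> to the real line.\<close>

lemma cauchy_diff_sums:
  fixes g :: "real \<Rightarrow> real"
  assumes g: "g \<in> borel_measurable lebesgue" and z0: "0 < Im z0"
    and int: "integrable lebesgue (\<lambda>t. g t / (cmod (z0 - of_real t))\<^sup>2)"
    and z: "cmod (z - z0) < Im z0"
  shows "(\<lambda>k. (-1) ^ Suc k * (LINT t|lebesgue. of_real (g t) / (z0 - of_real t) ^ Suc (Suc k)) * (z - z0) ^ Suc k)
           sums cauchy_diff g z0 z"
proof -
  define F where "F k t = (-1) ^ Suc k * (z - z0) ^ Suc k * (of_real (g t) / (z0 - of_real t) ^ (k + 2))" for k t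
  define M where "M = (LINT t|lebesgue. \<bar>g t\<bar> / (cmod (z0 - of_real t))\<^sup>2)"
  have sums: "(\<lambda>k. F k t) sums (of_real (g t) * (1 / (z - of_real t) - 1 / (z0 - of_real t)))" for t
  proof -
    have "cmod (z - z0) < cmod (z0 - of_real t)"
      using z Im_le_cmod_diff_of_real[of z0 t] by simp
    from sums_mult[OF sums_inverse_diff[OF this], of "of_real (g t)"] show ?thesis
      by (simp add: F_def mult_ac)
  qed
  have intF: "integrable lebesgue (F k)" for k
    unfolding F_def by (intro integrable_mult_right integrable_over_power(1)[OF g z0 int])
  have "(\<lambda>k. integral\<^sup>L lebesgue (F k)) sums (LINT t|lebesgue. (\<Sum>k. F k t))"
  proof (rule sums_integral[OF intF])
    show "AE t in lebesgue. summable (\<lambda>k. cmod (F k t))"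
    proof (rule AE_I2)
      fix t
      have le: "Im z0 \<le> cmod (z0 - of_real t)" by (rule Im_le_cmod_diff_of_real)
      have "summable (\<lambda>k. (cmod (z - z0) / cmod (z0 - of_real t)) ^ k)"
        using z z0 le by (intro summable_geometric) (auto simp: divide_less_eq)
      then have "summable (\<lambda>k. \<bar>g t\<bar> * cmod (z - z0) / (cmod (z0 - of_real t))\<^sup>2 * (cmod (z - z0) / cmod (z0 - of_real t)) ^ k)"
        by (rule summable_mult)
      also have "(\<lambda>k. \<bar>g t\<bar> * cmod (z - z0) / (cmod (z0 - of_real t))\<^sup>2 * (cmod (z - z0) / cmod (z0 - of_real t)) ^ k) = (\<lambda>k. cmod (F k t))"
        by (simp add: F_def norm_mult norm_divide norm_power power_add power_divide power2_eq_square mult_ac)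
      finally show "summable (\<lambda>k. cmod (F k t))" .
    qed
    have "summable (\<lambda>k. cmod (z - z0) * M * (cmod (z - z0) / Im z0) ^ k)"
      using z z0 by (intro summable_mult summable_geometric) auto
    then show "summable (\<lambda>k. LINT t|lebesgue. cmod (F k t))"
    proof (rule summable_comparison_test')
      fix k
      have "(LINT t|lebesgue. cmod (F k t)) = cmod (z - z0) ^ Suc k * (LINT t|lebesgue. cmod (of_real (g t) / (z0 - of_real t) ^ (k + 2)))"
        unfolding F_def norm_mult norm_power by simp
      also have "\<dots> \<le> cmod (z - z0) ^ Suc k * (M / Im z0 ^ k)"
        unfolding M_def by (intro mult_left_mono integrable_over_power(2)[OF g z0 int]) auto
      also have "\<dots> = cmod (z - z0) * M * (cmod (z - z0) / Im z0) ^ k"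
        by (simp add: power_divide)
      finally show "norm (LINT t|lebesgue. cmod (F k t)) \<le> cmod (z - z0) * M * (cmod (z - z0) / Im z0) ^ k"
        by simp
    qed
  qed
  also have "(LINT t|lebesgue. (\<Sum>k. F k t)) = cauchy_diff g z0 z"
    unfolding cauchy_diff_def using sums by (intro Bochner_Integration.integral_cong refl) (simp add: sums_iff)
  also have "(\<lambda>k. integral\<^sup>L lebesgue (F k)) =
     (\<lambda>k. (-1) ^ Suc k * (LINT t|lebesgue. of_real (g t) / (z0 - of_real t) ^ Suc (Suc k)) * (z - z0) ^ Suc k)"
    proof
    fix k
    have "integral\<^sup>L lebesgue (F k) = (-1) ^ Suc k * (z - z0) ^ Suc k *
        (LINT t|lebesgue. of_real (g t) / (z0 - of_real t) ^ (k + 2))"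
      unfolding F_def[abs_def] by (rule integral_mult_right_zero)
    then show "integral\<^sup>L lebesgue (F k) =
        (-1) ^ Suc k * (LINT t|lebesgue. of_real (g t) / (z0 - of_real t) ^ Suc (Suc k)) * (z - z0) ^ Suc k"
      by (simp add: mult_ac)
  qed
  finally show ?thesis .
qed

text \<open>The constants \<open>b\<close> and \<open>c\<close> let one statement serve both the
  bare kernel difference and an analytic function with given real part. Since the coefficient of
  order zero is \<open>c\<close> and not an integral, the derivative formula starts at order
  one.\<close>

lemma higher_deriv_cauchy_diff:
  fixes g :: "real \<Rightarrow> real"
  assumes g: "g \<in> borel_measurable lebesgue" and z0: "0 < Im z0"
    and int: "integrable lebesgue (\<lambda>t. g t / (cmod (z0 - of_real t))\<^sup>2)"
    and f: "\<And>w. w \<in> ball z0 (Im z0) \<Longrightarrow> f w = c + b * cauchy_diff g z0 w"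
  shows "f holomorphic_on ball z0 (Im z0)"
    and "n > 0 \<Longrightarrow> (deriv ^^ n) f z0 = fact n * b * (-1) ^ n * (LINT t|lebesgue. of_real (g t) / (z0 - of_real t) ^ Suc n)"
proof -
  define a where "a k = (if k = 0 then c else b * ((-1) ^ k * (LINT t|lebesgue. of_real (g t) / (z0 - of_real t) ^ Suc k)))" for k
  have *: "(\<lambda>k. a k * (w - z0) ^ k) sums f w" if w: "w \<in> ball z0 (Im z0)" for w
  proof -
    have "cmod (w - z0) < Im z0" using w by (simp add: dist_norm norm_minus_commute)
    from sums_mult[OF cauchy_diff_sums[OF g z0 int this], of b]
    have "(\<lambda>k. a (Suc k) * (w - z0) ^ Suc k) sums (b * cauchy_diff g z0 w)"
      by (simp add: a_def mult_ac)
    then show ?thesis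
      by (subst (asm) sums_Suc_iff) (simp add: a_def f[OF w] add.commute)
  qed
  show "f holomorphic_on ball z0 (Im z0)"
    by (rule power_series_holomorphic) (rule *)
  show "(deriv ^^ n) f z0 = fact n * b * (-1) ^ n * (LINT t|lebesgue. of_real (g t) / (z0 - of_real t) ^ Suc n)" if "n > 0"
    using higher_deriv_eq_coeff[OF z0 *] that by (simp add: a_def)
qed

section \<open>The kernel in the angular coordinate\<close>

text \<open>\<open>N\<close> stands for \<open>n + 1\<close> and \<open>\<alpha>\<close> for the
  phase of the unimodular factor; \<open>\<alpha> = 0\<close> gives the integral of the
  theorem.\<close>

definition phase_integral :: "nat \<Rightarrow> nat \<Rightarrow> real \<Rightarrow> real \<Rightarrow> real" where
  "phase_integral m N q \<alpha> =
     integral {-pi/2..pi/2} (\<lambda>\<phi>. \<bar>cos (real N * \<phi> + \<alpha>)\<bar> powr q * cos \<phi> ^ (2 * m))"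

text \<open>The Jacobian \<open>y / (cos \<phi>)\<^sup>2\<close> blows up at the end points. The
  identity is therefore required only inside, while continuity of the product \<open>G\<close> up to
  the end points supplies absolute integrability without estimates.\<close>

lemma has_bochner_integral_tan_subst:
  fixes F G :: "real \<Rightarrow> real"
  assumes y: "0 < y" and G: "continuous_on {-pi/2..pi/2} G"
    and FG: "\<And>\<phi>. \<phi> \<in> {-pi/2<..<pi/2} \<Longrightarrow> y / (cos \<phi>)\<^sup>2 * F (x + y * tan \<phi>) = G \<phi>"
  shows "has_bochner_integral lebesgue F (integral {-pi/2..pi/2} G)"
proof -
  define S where "S = {-pi/2<..<pi/2::real}"
  define h where "h \<phi> = x + y * tan \<phi>" for \<phi>
  have cos0: "cos \<phi> > 0" if "\<phi> \<in> S" for \<phi>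
    using that by (intro cos_gt_zero_pi) (auto simp: S_def)
  have der: "(h has_field_derivative y / (cos \<phi>)\<^sup>2) (at \<phi> within S)" if "\<phi> \<in> S" for \<phi>
    unfolding h_def using cos0[OF that]
    by (auto intro!: derivative_eq_intros simp: field_simps power2_eq_square)
  have inj: "inj_on h S"
  proof (rule inj_onI)
    fix a b assume ab: "a \<in> S" "b \<in> S" "h a = h b"
    then have "arctan (tan a) = arctan (tan b)"
      using y by (simp add: h_def)
    moreover have "arctan (tan c) = c" if "c \<in> S" for c
      using that by (intro arctan_tan) (auto simp: S_def)
    ultimately show "a = b" using ab by simp
  qed
  have img: "h ` S = UNIV"
  proof -
    have "t \<in> h ` S" for t
    proof (rule image_eqI[of _ _ "arctan ((t - x) / y)"])
      show "t = h (arctan ((t - x) / y))" using y by (simp add: h_def tan_arctan)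
      show "arctan ((t - x) / y) \<in> S"
        using arctan_lbound[of "(t-x)/y"] arctan_ubound[of "(t-x)/y"] by (auto simp: S_def)
    qed
    then show ?thesis by auto
  qed
  have aG: "G absolutely_integrable_on S"
    by (rule set_integrable_subset[OF absolutely_integrable_continuous_real[OF G]])
       (auto simp: S_def)
  have "S \<in> sets lebesgue" by (simp add: S_def)
  note cv = has_absolute_integral_change_of_variables_1'[OF this der inj, of F "integral S G"]
  have eq: "\<bar>y / (cos \<phi>)\<^sup>2\<bar> * F (h \<phi>) = G \<phi>" if "\<phi> \<in> S" for \<phi>
    using FG[of \<phi>] that y by (simp add: S_def h_def)
  have "(\<lambda>\<phi>. \<bar>y / (cos \<phi>)\<^sup>2\<bar> * F (h \<phi>)) absolutely_integrable_on S"
    using aG by (subst set_integrable_cong[OF refl refl eq])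
  moreover have "integral S (\<lambda>\<phi>. \<bar>y / (cos \<phi>)\<^sup>2\<bar> * F (h \<phi>)) = integral S G"
    by (rule integral_cong) (rule eq)
  ultimately have "F absolutely_integrable_on UNIV" "integral UNIV F = integral S G"
    using cv img by auto
  then have "integrable lebesgue F" and "integral\<^sup>L lebesgue F = integral S G"
    using lebesgue_integral_eq_integral[of UNIV F]
    by (auto simp: set_integrable_def absolutely_integrable_on_def lebesgue_on_UNIV_eq)
  moreover have "integral S G = integral {-pi/2..pi/2} G"
    by (simp add: S_def integral_open_interval_real)
  ultimately show ?thesis by (simp add: has_bochner_integral_iff)
qed

text \<open>In the angular coordinate the integrand times the Jacobian is the constant
  \<open>1 / Im z\<close>.\<close>

lemma poisson_kernel_integrable:
  assumes "0 < Im z"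
  shows "integrable lebesgue (\<lambda>t. 1 / (cmod (z - of_real t))\<^sup>2)"
proof -
  define y where "y = Im z"
  have y: "y > 0" using assms by (simp add: y_def)
  have "has_bochner_integral lebesgue (\<lambda>t. 1 / (cmod (z - of_real t))\<^sup>2) (integral {-pi/2..pi/2} (\<lambda>_. 1 / y))"
  proof (rule has_bochner_integral_tan_subst[OF y, where x = "Re z"])
    fix \<phi> :: real assume "\<phi> \<in> {-pi/2<..<pi/2}"
    then have c: "cos \<phi> > 0" by (intro cos_gt_zero_pi) auto
    have "(cmod (z - of_real (Re z + y * tan \<phi>)))\<^sup>2 = y\<^sup>2 * (1 + (tan \<phi>)\<^sup>2)"
      by (simp only: cmod_power2) (simp add: y_def algebra_simps power2_eq_square)
    also have "\<dots> = y\<^sup>2 / (cos \<phi>)\<^sup>2"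
      using c by (simp add: tan_sec[of \<phi>] power_inverse divide_inverse)
    finally have *: "(cmod (z - of_real (Re z + y * tan \<phi>)))\<^sup>2 = y\<^sup>2 / (cos \<phi>)\<^sup>2" .
    show "y / (cos \<phi>)\<^sup>2 * (1 / (cmod (z - of_real (Re z + y * tan \<phi>)))\<^sup>2) = 1 / y"
      unfolding * using c y by (simp add: power2_eq_square)
  qed auto
  then show ?thesis by (rule integrable.intros)
qed

text \<open>In the coordinate \<open>t = Re z + Im z * tan \<phi>\<close> one has \<open>z - t = \<i> * Im z * cis \<phi> / cos \<phi>\<close>.\<close>

lemma kernel_power_integral:
  assumes z: "0 < Im z" and N: "0 < N" and q: "real N * q = 2 * (real m + 1)"
  shows "has_bochner_integral lebesgue
           (\<lambda>t. \<bar>Re (cis (real N * (pi / 2) - \<alpha>) / (z - of_real t) ^ N)\<bar> powr q)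
           (phase_integral m N q \<alpha> / Im z ^ (2 * m + 1))"
proof -
  define y where "y = Im z"
  have y: "y > 0" using z by (simp add: y_def)
  have q0: "q > 0" using q N by (smt (verit) mult_nonneg_nonpos of_nat_0_le_iff)
  define G where "G \<phi> = \<bar>cos (real N * \<phi> + \<alpha>)\<bar> powr q * cos \<phi> ^ (2 * m) / y ^ (2 * m + 1)" for \<phi>
  have "has_bochner_integral lebesgue
           (\<lambda>t. \<bar>Re (cis (real N * (pi / 2) - \<alpha>) / (z - of_real t) ^ N)\<bar> powr q)
           (integral {-pi/2..pi/2} G)"
  proof (rule has_bochner_integral_tan_subst[OF y, where x = "Re z"])
    show "continuous_on {-pi/2..pi/2} G"
      unfolding G_def using y q0 by (intro continuous_intros continuous_on_powr') auto
    fix \<phi> :: real assume "\<phi> \<in> {-pi/2<..<pi/2}"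
    then have c: "cos \<phi> > 0" by (intro cos_gt_zero_pi) auto
    have "z - of_real (Re z + y * tan \<phi>) = of_real (y / cos \<phi>) * cis (pi / 2 + \<phi>)"
      using c by (simp add: complex_eq_iff y_def tan_def cos_add sin_add)
    then have "(z - of_real (Re z + y * tan \<phi>)) ^ N = of_real ((y / cos \<phi>) ^ N) * cis (real N * (pi / 2 + \<phi>))"
      by (simp only: power_mult_distrib Complex.DeMoivre of_real_power)
    \<comment> \<open>The factor \<open>cis (N * pi / 2)\<close> cancels the power
      \<open>\<i> ^ N\<close> in the kernel, so that the phase left over is exactly
      \<open>\<alpha>\<close>.\<close>
    then have "cis (real N * (pi / 2) - \<alpha>) / (z - of_real (Re z + y * tan \<phi>)) ^ N
        = inverse (of_real ((y / cos \<phi>) ^ N)) * (cis (real N * (pi / 2) - \<alpha>) / cis (real N * (pi / 2 + \<phi>)))"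
      by (simp only: divide_inverse inverse_mult_distrib mult_ac)
    also have "inverse (of_real ((y / cos \<phi>) ^ N)) = complex_of_real ((cos \<phi> / y) ^ N)"
      by (simp add: power_divide)
    also have "cis (real N * (pi / 2) - \<alpha>) / cis (real N * (pi / 2 + \<phi>)) = cis (- (real N * \<phi> + \<alpha>))"
      by (simp add: cis_divide algebra_simps)
    finally have "Re (cis (real N * (pi / 2) - \<alpha>) / (z - of_real (Re z + y * tan \<phi>)) ^ N)
        = (cos \<phi> / y) ^ N * cos (real N * \<phi> + \<alpha>)"
      by (simp del: of_real_power minus_add_distrib)
    then have "\<bar>Re (cis (real N * (pi / 2) - \<alpha>) / (z - of_real (Re z + y * tan \<phi>)) ^ N)\<bar> powr q
        = ((cos \<phi> / y) ^ N) powr q * \<bar>cos (real N * \<phi> + \<alpha>)\<bar> powr q"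
      using c y by (simp add: abs_mult powr_mult)
    \<comment> \<open>Here \<open>N * q = 2 * m + 2\<close> turns a real power into an integer one;
      multiplying by the Jacobian then leaves
      \<open>cos \<phi> ^ (2 * m) / y ^ (2 * m + 1)\<close>.\<close>
    also have "((cos \<phi> / y) ^ N) powr q = (cos \<phi> / y) powr real (2 * m + 2)"
      using c y q by (simp add: powr_powr add.commute flip: powr_realpow)
    also have "\<dots> = (cos \<phi> / y) ^ (2 * m + 2)"
      using c y by (intro powr_realpow) simp
    finally show "y / (cos \<phi>)\<^sup>2 * \<bar>Re (cis (real N * (pi / 2) - \<alpha>) / (z - of_real (Re z + y * tan \<phi>)) ^ N)\<bar> powr q = G \<phi>"
      unfolding G_def using c y by (simp add: power_divide field_simps power2_eq_square)
  qed
  also have "integral {-pi/2..pi/2} G = phase_integral m N q \<alpha> / Im z ^ (2 * m + 1)"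
    unfolding G_def phase_integral_def y_def by simp
  finally show ?thesis .
qed

section \<open>Fourier coefficients\<close>

lemma integral_periodic_shift:
  fixes h :: "real \<Rightarrow> 'a::euclidean_space"
  assumes h: "continuous_on UNIV h" and per: "\<And>x. h (x + p) = h x" and p: "0 \<le> p"
  shows "integral {a..a + p} h = integral {b..b + p} h"
proof -
  have int: "h integrable_on {c..d}" for c d
    by (rule integrable_continuous_real) (rule continuous_on_subset[OF h], simp)
  \<comment> \<open>Within one period the piece cut off on the left reappears on the right; whole
    periods and arbitrary shifts are reduced to this.\<close>
  have *: "integral {a..a + p} h = integral {b..b + p} h" if "a \<le> b" "b \<le> a + p" for a b
  proof -
    have "integral {a + p..b + p} h = integral {a..b} (\<lambda>x. h (x + p))"
      using integral_shift_real_ivl[of "a + p" p "b + p" h] by simp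
    moreover have "integral {a..b} h + integral {b..a + p} h = integral {a..a + p} h"
      using that by (intro Henstock_Kurzweil_Integration.integral_combine int) auto
    moreover have "integral {b..a + p} h + integral {a + p..b + p} h = integral {b..b + p} h"
      using that p by (intro Henstock_Kurzweil_Integration.integral_combine int) auto
    ultimately show ?thesis by (simp add: per algebra_simps)
  qed
  have **: "integral {a..a + p} h = integral {a + real k * p..a + real k * p + p} h" for a k
  proof (induction k)
    case (Suc k)
    with *[of "a + real k * p" "a + real (Suc k) * p"] p show ?case
      by (simp add: algebra_simps)
  qed simp
  have le: "integral {a..a + p} h = integral {b..b + p} h" if ab: "a \<le> b" for a b
  proof (cases "p = 0")
    case False
    define k where "k = nat \<lfloor>(b - a) / p\<rfloor>"
    have "real k \<le> (b - a) / p" "(b - a) / p \<le> real k + 1"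
      using ab p unfolding k_def by (auto simp: of_nat_nat divide_nonneg_nonneg)
    then have "a + real k * p \<le> b" "b \<le> a + real k * p + p"
      using False p by (auto simp: field_simps)
    with ** * show ?thesis by metis
  qed simp
  show ?thesis
    using le[of a b] le[of b a] linear[of a b] by metis
qed

text \<open>The image interval consists of \<open>N\<close> full periods, and this factor cancels
  the derivative \<open>N\<close> of the substitution.\<close>

lemma integral_periodic_scale:
  fixes h :: "real \<Rightarrow> 'a::euclidean_space"
  assumes h: "continuous_on UNIV h" and per: "\<And>x. h (x + p) = h x" and p: "0 \<le> p" and N: "0 < N"
  shows "integral {a..a + p} (\<lambda>x. h (real N * x + c)) = integral {b..b + p} h"
proof -
  have int: "h integrable_on {c..d}" for c d
    by (rule integrable_continuous_real) (rule continuous_on_subset[OF h], simp)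
  have sum: "integral {u..u + real k * p} h = real k *\<^sub>R integral {b..b + p} h" for k u
  proof (induction k)
    case (Suc k)
    have "integral {u..u + real (Suc k) * p} h
        = integral {u..u + real k * p} h + integral {u + real k * p..u + real k * p + p} h"
      using p by (subst Henstock_Kurzweil_Integration.integral_combine) (auto intro: int simp: algebra_simps)
    also have "integral {u + real k * p..u + real k * p + p} h = integral {b..b + p} h"
      by (rule integral_periodic_shift[OF h per p])
    finally show ?case using Suc by (simp add: algebra_simps)
  qed simp
  have "((\<lambda>x. real N *\<^sub>R h (real N * x + c)) has_integral
          integral {real N * a + c..real N * (a + p) + c} h) {a..a + p}"
  proof (rule has_integral_substitution)
    show "continuous_on {real N * a + c..real N * (a + p) + c} h"
      by (rule continuous_on_subset[OF h]) simp
    show "(\<lambda>x. real N * x + c) ` {a..a + p} \<subseteq> {real N * a + c..real N * (a + p) + c}"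
      using N by (auto intro!: mult_left_mono)
    show "((\<lambda>x. real N * x + c) has_real_derivative real N) (at x within {a..a + p})" for x
      by (auto intro!: derivative_eq_intros)
  qed (use p N in \<open>auto intro!: mult_left_mono\<close>)
  also have "real N * (a + p) + c = (real N * a + c) + real N * p" by (simp add: algebra_simps)
  finally have "((\<lambda>x. real N *\<^sub>R h (real N * x + c)) has_integral real N *\<^sub>R integral {b..b + p} h) {a..a + p}"
    by (simp only: sum)
  from has_integral_cmul[OF this, of "inverse (real N)"] N show ?thesis
    by (simp add: integral_unique)
qed

text \<open>Up to normalisation, the Fourier cosine coefficient of index \<open>j\<close> of
  \<open>\<bar>cos x\<bar> powr q\<close>, which has period \<open>pi\<close>; hence the frequency
  \<open>2 * j\<close>.\<close>

definition cos_moment :: "real \<Rightarrow> nat \<Rightarrow> real" where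
  "cos_moment q j = integral {-pi/2..pi/2} (\<lambda>x. \<bar>cos x\<bar> powr q * cos (2 * real j * x))"

lemma continuous_on_abs_cos_powr [continuous_intros]:
  fixes f :: "real \<Rightarrow> real"
  shows "continuous_on A f \<Longrightarrow> 0 < q \<Longrightarrow> continuous_on A (\<lambda>x. \<bar>cos (f x)\<bar> powr (q :: real))"
  by (intro continuous_on_powr' continuous_on_rabs continuous_on_cos continuous_on_const) auto

text \<open>Shifting the variable by \<open>pi / N\<close> multiplies the integral by \<open>cis (2 * pi * k / N)\<close>,
  so that it vanishes unless \<open>N\<close> divides \<open>k\<close>.\<close>

lemma abs_cos_fourier_coeff:
  assumes q: "0 < q" and N: "0 < N"
  shows "integral {-pi/2..pi/2} (\<lambda>x. \<bar>cos (real N * x + \<alpha>)\<bar> powr q * cos (2 * real k * x))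
     = (if N dvd k then cos (2 * real (k div N) * \<alpha>) * cos_moment q (k div N) else 0)"
proof -
  \<comment> \<open>With complex exponentials instead of cosines, a shift of the variable acts as
    multiplication by a number.\<close>
  define S where "S x = complex_of_real (\<bar>cos (real N * x + \<alpha>)\<bar> powr q) * cis (2 * real k * x)" for x
  define I where "I = integral {-pi/2..pi/2} S"
  have contS: "continuous_on A S" for A
    unfolding S_def using q by (intro continuous_intros)
  have intS: "S integrable_on {a..b}" for a b
    by (intro integrable_continuous_real contS)
  have cos_pi: "\<bar>cos (x + real n * pi)\<bar> = \<bar>cos x\<bar>" for x n
    by (induction n) (simp_all add: algebra_simps cos_add)
  have perS: "S (x + pi) = S x" for x
  proof -
    have "\<bar>cos (real N * (x + pi) + \<alpha>)\<bar> = \<bar>cos (real N * x + \<alpha>)\<bar>"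
      using cos_pi[of "real N * x + \<alpha>" N] by (simp add: algebra_simps)
    moreover have "cis (2 * real k * (x + pi)) = cis (2 * real k * x)"
      using cos_2npi[of k] sin_2npi[of k] by (simp only: distrib_left cis_mult[symmetric]) (simp add: cis.ctr one_complex.ctr)
    ultimately show ?thesis by (simp add: S_def)
  qed
  have Re: "integral {-pi/2..pi/2} (\<lambda>x. \<bar>cos (real N * x + \<alpha>)\<bar> powr q * cos (2 * real k * x)) = Re I"
    using integral_linear[OF intS bounded_linear_Re, of "-pi/2" "pi/2"] by (simp add: I_def S_def comp_def)
  show ?thesis
  proof (cases "N dvd k")
    case True
    then obtain j where k: "k = N * j" by blast
    define F where "F x = complex_of_real (\<bar>cos x\<bar> powr q) * cis (2 * real j * x)" for x
    have contF: "continuous_on A F" for A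
      unfolding F_def using q by (intro continuous_intros)
    have perF: "F (x + pi) = F x" for x
    proof -
      have "cis (2 * real j * (x + pi)) = cis (2 * real j * x)"
        using cos_2npi[of j] sin_2npi[of j] by (simp only: distrib_left cis_mult[symmetric]) (simp add: cis.ctr one_complex.ctr)
      then show ?thesis using cos_pi[of x 1] by (simp add: F_def)
    qed
    have intF: "F integrable_on {a..b}" for a b
      by (intro integrable_continuous_real contF)
    define J where "J = integral {-pi/2..pi/2} F"
    \<comment> \<open>For \<open>k = N * j\<close> the exponential is itself a function of
      \<open>N * x + \<alpha>\<close>, up to a constant of modulus one.\<close>
    have "S = (\<lambda>x. cis (- (2 * real j * \<alpha>)) * F (real N * x + \<alpha>))"
      by (simp add: fun_eq_iff S_def F_def k mult_ac cis_mult algebra_simps)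
    then have "I = cis (- (2 * real j * \<alpha>)) * integral {-pi/2..pi/2} (\<lambda>x. F (real N * x + \<alpha>))"
      by (simp only: I_def integral_mult_right)
    also have "integral {-pi/2..pi/2} (\<lambda>x. F (real N * x + \<alpha>)) = J"
      using integral_periodic_scale[OF contF perF _ N, of "-pi/2" \<alpha> "-pi/2"] by (simp add: J_def)
    finally have I: "I = cis (- (2 * real j * \<alpha>)) * J" .
    have ReJ: "Re J = cos_moment q j"
      using integral_linear[OF intF bounded_linear_Re, of "-pi/2" "pi/2"]
      by (simp add: J_def F_def comp_def cos_moment_def)
    \<comment> \<open>Reflection conjugates \<open>F\<close>, so \<open>J\<close> is real and the
      sine of the phase drops out of \<open>Re I\<close>.\<close>
    have "J = integral {-pi/2..pi/2} (\<lambda>x. F (- x))"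
      using Henstock_Kurzweil_Integration.integral_reflect_real[of "pi/2" "-pi/2" F] by (simp add: J_def)
    also have "\<dots> = integral {-pi/2..pi/2} (cnj \<circ> F)"
      by (simp add: F_def comp_def cis_cnj)
    also have "\<dots> = cnj J"
      unfolding J_def by (rule integral_linear[OF intF bounded_linear_cnj])
    finally have "Im J = 0" by (simp add: complex_eq_iff)
    then show ?thesis
      unfolding Re using N by (simp add: I k ReJ)
  next
    case False
    have "S (x + pi / N) = cis (2 * pi * real k / real N) * S x" for x
    proof -
      have "\<bar>cos (real N * (x + pi / N) + \<alpha>)\<bar> = \<bar>cos (real N * x + \<alpha>)\<bar>"
        using cos_pi[of "real N * x + \<alpha>" 1] N by (simp add: algebra_simps)
      moreover have "cis (2 * real k * (x + pi / N)) = cis (2 * pi * real k / real N) * cis (2 * real k * x)"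
        by (simp add: distrib_left cis_mult[symmetric] mult_ac)
      ultimately show ?thesis by (simp add: S_def)
    qed
    then have "cis (2 * pi * real k / real N) * I = integral {-pi/2..pi/2} (\<lambda>x. S (x + pi / N))"
      by (simp add: I_def)
    also have "\<dots> = integral {-pi/2 + pi / N..pi/2 + pi / N} S"
      using integral_shift_real_ivl[of "-pi/2 + pi / N" "pi / N" "pi/2 + pi / N" S] by simp
    also have "\<dots> = I"
      using integral_periodic_shift[OF contS perS, of "-pi/2 + pi / N" "-pi/2"] by (simp add: I_def)
    finally have "(cis (2 * pi * real k / real N) - 1) * I = 0" by (simp add: algebra_simps)
    moreover have "cis (2 * pi * real k / real N) \<noteq> 1"
    proof
      assume "cis (2 * pi * real k / real N) = 1"
      then have "cos (2 * pi * real k / real N) = 1" by (simp add: complex_eq_iff)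
      then obtain l :: int where "2 * pi * real k / real N = of_int l * 2 * pi"
        unfolding cos_one_2pi_int by blast
      then have "real k = real N * of_int l" using N by (simp add: field_simps)
      then have "int k = int N * l" by (metis of_int_eq_iff of_int_mult of_int_of_nat_eq)
      then have "int N dvd int k" by simp
      with False show False by simp
    qed
    ultimately have "I = 0" by simp
    with False Re show ?thesis by simp
  qed
qed

text \<open>Binomial expansion of \<open>(cis x + cis (- x)) ^ (2 * m)\<close>, folded about the
  middle index \<open>m\<close>.\<close>

lemma cos_power_even_fourier:
  "2 ^ (2 * m) * cos x ^ (2 * m) =
     real ((2 * m) choose m) + 2 * (\<Sum>k = 1..m. real ((2 * m) choose (m - k)) * cos (2 * real k * x))"
proof -
  define f where "f i = real ((2 * m) choose i) * cos (2 * (real m - real i) * x)" for i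
  have "complex_of_real (2 * cos x) ^ (2 * m) = (cis x + cis (- x)) ^ (2 * m)"
    by (simp add: complex_eq_iff cis.ctr)
  also have "\<dots> = (\<Sum>i\<le>2 * m. of_nat ((2 * m) choose i) * cis x ^ i * cis (- x) ^ (2 * m - i))"
    by (rule binomial_ring)
  also have "\<dots> = (\<Sum>i\<le>2 * m. of_nat ((2 * m) choose i) * cis (2 * (real i - real m) * x))"
    by (intro sum.cong refl)
       (simp add: Complex.DeMoivre mult.assoc cis_mult of_nat_diff algebra_simps)
  finally have "Re (complex_of_real (2 * cos x) ^ (2 * m)) =
      Re (\<Sum>i\<le>2 * m. of_nat ((2 * m) choose i) * cis (2 * (real i - real m) * x))" by simp
  then have "(2 * cos x) ^ (2 * m) = (\<Sum>i\<le>2 * m. f i)"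
  proof -
    have "cos (2 * (real i - real m) * x) = cos (2 * (real m - real i) * x)" for i
      using cos_minus[of "2 * (real i - real m) * x"] by (simp add: algebra_simps)
    with \<open>Re _ = Re _\<close> show ?thesis by (simp add: f_def flip: of_real_power)
  qed
  also have "{..2 * m} = {..<m} \<union> {m} \<union> {m<..2 * m}" by auto
  also have "(\<Sum>i\<in>{..<m} \<union> {m} \<union> {m<..2 * m}. f i) = (\<Sum>i<m. f i) + f m + (\<Sum>i\<in>{m<..2 * m}. f i)"
    by (subst sum.union_disjoint; (subst sum.union_disjoint)?) auto
  \<comment> \<open>The indices \<open>i\<close> and \<open>2 * m - i\<close> have equal binomial
    coefficients and opposite frequencies.\<close>
  also have "(\<Sum>i\<in>{m<..2 * m}. f i) = (\<Sum>i<m. f i)"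
  proof (rule sum.reindex_bij_witness[of _ "\<lambda>i. 2 * m - i" "\<lambda>i. 2 * m - i"])
    fix i assume i: "i \<in> {m<..2 * m}"
    then have "(2 * m) choose (2 * m - i) = (2 * m) choose i"
      using binomial_symmetric[of i "2 * m"] by simp
    moreover have "cos (2 * (real m - real (2 * m - i)) * x) = cos (2 * (real m - real i) * x)"
      using i cos_minus[of "2 * (real m - real i) * x"] by (simp add: of_nat_diff algebra_simps)
    ultimately show "f (2 * m - i) = f i" by (simp add: f_def)
  qed auto
  also have "(\<Sum>i<m. f i) = (\<Sum>k = 1..m. real ((2 * m) choose (m - k)) * cos (2 * real k * x))"
    by (rule sum.reindex_bij_witness[of _ "\<lambda>k. m - k" "\<lambda>i. m - i"]) (auto simp: f_def of_nat_diff)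
  finally show ?thesis by (simp add: f_def power_mult_distrib)
qed

lemma phase_integral_expansion:
  assumes q: "0 < q" and N: "0 < N"
  shows "2 ^ (2 * m) * phase_integral m N q \<alpha> =
     real ((2 * m) choose m) * cos_moment q 0 +
     2 * (\<Sum>j = 1..m div N. real ((2 * m) choose (m - j * N)) * cos_moment q j * cos (2 * real j * \<alpha>))"
proof -
  define h where "h x = \<bar>cos (real N * x + \<alpha>)\<bar> powr q" for x
  define A where "A k = integral {-pi/2..pi/2} (\<lambda>x. h x * cos (2 * real k * x))" for k
  have A: "A k = (if N dvd k then cos (2 * real (k div N) * \<alpha>) * cos_moment q (k div N) else 0)" for k
    unfolding A_def h_def by (rule abs_cos_fourier_coeff[OF q N])
  have int: "(\<lambda>x. h x * cos (2 * real k * x)) integrable_on {-pi/2..pi/2}" for k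
    unfolding h_def using q by (intro integrable_continuous_real continuous_intros)
  have "2 ^ (2 * m) * phase_integral m N q \<alpha> =
      integral {-pi/2..pi/2} (\<lambda>x. h x * (2 ^ (2 * m) * cos x ^ (2 * m)))"
    unfolding phase_integral_def h_def by (simp flip: integral_mult_right add: mult_ac)
  also have "\<dots> = integral {-pi/2..pi/2} (\<lambda>x. real ((2 * m) choose m) * (h x * cos (2 * real 0 * x)) +
      2 * (\<Sum>k = 1..m. real ((2 * m) choose (m - k)) * (h x * cos (2 * real k * x))))"
    unfolding cos_power_even_fourier by (simp add: algebra_simps sum_distrib_left)
  also have "\<dots> = integral {-pi/2..pi/2} (\<lambda>x. real ((2 * m) choose m) * (h x * cos (2 * real 0 * x))) +
      integral {-pi/2..pi/2} (\<lambda>x. 2 * (\<Sum>k = 1..m. real ((2 * m) choose (m - k)) * (h x * cos (2 * real k * x))))"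
    by (intro Henstock_Kurzweil_Integration.integral_add integrable_on_mult_right integrable_sum int finite_atLeastAtMost)
  also have "integral {-pi/2..pi/2} (\<lambda>x. 2 * (\<Sum>k = 1..m. real ((2 * m) choose (m - k)) * (h x * cos (2 * real k * x))))
      = 2 * (\<Sum>k = 1..m. integral {-pi/2..pi/2} (\<lambda>x. real ((2 * m) choose (m - k)) * (h x * cos (2 * real k * x))))"
    by (subst integral_mult_right)
       (intro arg_cong[of _ _ "(*) 2"] Henstock_Kurzweil_Integration.integral_sum[OF finite_atLeastAtMost] integrable_on_mult_right int)
  also have "integral {-pi/2..pi/2} (\<lambda>x. real ((2 * m) choose m) * (h x * cos (2 * real 0 * x)))
      = real ((2 * m) choose m) * A 0"
    unfolding A_def by (rule integral_mult_right)
  also have "(\<Sum>k = 1..m. integral {-pi/2..pi/2} (\<lambda>x. real ((2 * m) choose (m - k)) * (h x * cos (2 * real k * x))))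
      = (\<Sum>k = 1..m. real ((2 * m) choose (m - k)) * A k)"
    unfolding A_def by (simp only: integral_mult_right)
  also have "(\<Sum>k = 1..m. real ((2 * m) choose (m - k)) * A k)
      = (\<Sum>k\<in>{k\<in>{1..m}. N dvd k}. real ((2 * m) choose (m - k)) * A k)"
    by (rule sum.mono_neutral_right) (auto simp: A)
  \<comment> \<open>\<open>j * N \<le> m\<close> means \<open>j \<le> m div N\<close>: this is the
    origin of the upper limit \<open>[m / (n + 1)]\<close>.\<close>
  also have "\<dots> = (\<Sum>j = 1..m div N. real ((2 * m) choose (m - j * N)) * A (j * N))"
    by (rule sum.reindex_bij_witness[of _ "\<lambda>j. j * N" "\<lambda>k. k div N"])
       (use N in \<open>auto simp: div_le_mono less_eq_div_iff_mult_less_eq Suc_le_eq dvd_imp_le div_greater_zero_iff\<close>)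
  also have "\<dots> = (\<Sum>j = 1..m div N. real ((2 * m) choose (m - j * N)) * cos_moment q j * cos (2 * real j * \<alpha>))"
    using N by (simp add: A mult_ac)
  finally show ?thesis by (simp add: A)
qed

section \<open>Cosine moments as values of Gamma and Beta\<close>

lemma Beta_pos:
  fixes a b :: real
  assumes "0 < a" "0 < b"
  shows "0 < Beta a b"
  using assms unfolding Beta_def by (intro divide_pos_pos mult_pos_pos Gamma_real_pos) auto

lemma Gamma_plus1_pos_real: "0 < x \<Longrightarrow> Gamma (x + 1) = x * Gamma (x :: real)"
  by (rule Gamma_plus1) (auto dest: nonpos_Ints_nonpos)

text \<open>Needed to pass between the two Beta forms of the zeroth cosine moment.\<close>

lemma Gamma_legendre_duplication_real:
  fixes x :: real
  assumes "0 < x"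
  shows "Gamma x * Gamma (x + 1/2) = 2 powr (1 - 2 * x) * sqrt pi * Gamma (2 * x)"
proof -
  have "complex_of_real x \<notin> \<int>\<^sub>\<le>\<^sub>0" "complex_of_real x + 1/2 \<notin> \<int>\<^sub>\<le>\<^sub>0"
    using assms by (auto elim!: nonpos_Ints_cases' simp: complex_eq_iff)
  from Gamma_legendre_duplication[OF this]
  have "Gamma (complex_of_real x) * Gamma (complex_of_real (x + 1/2)) =
      exp (complex_of_real ((1 - 2 * x) * ln 2)) * of_real (sqrt pi) * Gamma (complex_of_real (2 * x))"
    by simp
  then have "complex_of_real (Gamma x * Gamma (x + 1/2)) =
      complex_of_real (exp ((1 - 2 * x) * ln 2) * sqrt pi * Gamma (2 * x))"
    unfolding exp_of_real Gamma_complex_of_real by (simp only: of_real_mult)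
  then show ?thesis
    by (simp only: of_real_eq_iff) (simp add: powr_def)
qed

text \<open>The substitution \<open>t = (sin x)\<^sup>2\<close> in Euler's integral.\<close>

lemma cos_moment_0:
  assumes q: "0 < q"
  shows "cos_moment q 0 = Beta (q / 2 + 1 / 2) (1 / 2)"
proof -
  define S where "S = {0<..<pi/2::real}"
  define B where "B = Beta (1 / 2) (q / 2 + 1 / 2)"
  \<comment> \<open>Exponents matched to \<open>t = (sin x)^2\<close>:
    \<open>t powr (- 1 / 2)\<close> cancels the sine of the Jacobian, and
    \<open>(1 - t) powr ((q - 1) / 2)\<close> together with its cosine becomes
    \<open>cos x powr q\<close>.\<close>
  define f where "f t = t powr (1 / 2 - 1) * (1 - t) powr (q / 2 + 1 / 2 - 1)" for t :: real
  have f: "(f has_integral B) {0<..<1}"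
    unfolding f_def B_def using has_integral_Beta_real[of "1 / 2" "q / 2 + 1 / 2"] q
    by (simp add: has_integral_Icc_iff_Ioo)
  have af: "f absolutely_integrable_on {0<..<1}"
    by (rule nonnegative_absolutely_integrable_1) (use f in \<open>auto simp: f_def\<close>)
  have sc: "0 < sin x" "0 < cos x" if "x \<in> S" for x
    using that by (auto simp: S_def intro!: sin_gt_zero cos_gt_zero)
  have der: "((\<lambda>x. (sin x)\<^sup>2) has_field_derivative 2 * sin x * cos x) (at x within S)" for x
    by (auto intro!: derivative_eq_intros)
  have inj: "inj_on (\<lambda>x. (sin x)\<^sup>2) S"
  proof (rule inj_onI)
    fix x y assume xy: "x \<in> S" "y \<in> S" "(sin x)\<^sup>2 = (sin y)\<^sup>2"
    then have "sin x = sin y" using sc by (smt (verit) power2_eq_imp_eq)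
    then have "arcsin (sin x) = arcsin (sin y)" by simp
    moreover have "arcsin (sin z) = z" if "z \<in> S" for z
      using that by (intro arcsin_sin) (auto simp: S_def)
    ultimately show "x = y" using xy by simp
  qed
  have img: "(\<lambda>x. (sin x)\<^sup>2) ` S = {0<..<1}"
  proof safe
    fix x assume x: "x \<in> S"
    show "(sin x)\<^sup>2 \<in> {0<..<1}"
      using zero_less_power[OF sc(1)[OF x], of 2] zero_less_power[OF sc(2)[OF x], of 2]
        sin_cos_squared_add[of x] unfolding greaterThanLessThan_iff by linarith
  next
    fix t :: real assume t: "t \<in> {0<..<1}"
    show "t \<in> (\<lambda>x. (sin x)\<^sup>2) ` S"
    proof (rule image_eqI)
      have s: "0 < sqrt t" "sqrt t < 1" using t by auto
      then have "sin (arcsin (sqrt t)) = sqrt t" by (intro sin_arcsin; linarith)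
      then show "t = (sin (arcsin (sqrt t)))\<^sup>2" using t by simp
      show "arcsin (sqrt t) \<in> S"
        using s arcsin_lt_bounded[of "sqrt t"] arcsin_less_arcsin[of 0 "sqrt t"]
        unfolding S_def arcsin_0 greaterThanLessThan_iff by linarith
    qed
  qed
  have "S \<in> sets lebesgue" by (simp add: S_def)
  from has_absolute_integral_change_of_variables_1'[OF this der inj, of f B] af f img
  have "integral S (\<lambda>x. \<bar>2 * sin x * cos x\<bar> * f ((sin x)\<^sup>2)) = B"
    by (simp add: integral_unique)
  also have "integral S (\<lambda>x. \<bar>2 * sin x * cos x\<bar> * f ((sin x)\<^sup>2)) = integral S (\<lambda>x. 2 * \<bar>cos x\<bar> powr q)"
  proof (rule integral_cong)
    fix x assume x: "x \<in> S"
    note p = sc[OF x]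
    have "f ((sin x)\<^sup>2) = (sin x) powr (-1) * (cos x) powr (q - 1)"
    proof -
      have 1: "((sin x)\<^sup>2) powr (1 / 2 - 1) = (sin x) powr (-1)"
        using p powr_powr[of "sin x" 2 "-1/2"] by simp
      have 2: "1 - (sin x)\<^sup>2 = (cos x)\<^sup>2" by (simp add: cos_squared_eq)
      have 3: "((cos x)\<^sup>2) powr (q / 2 + 1 / 2 - 1) = (cos x) powr (q - 1)"
        using p powr_powr[of "cos x" 2 "q / 2 + 1 / 2 - 1"] by (simp add: algebra_simps)
      show ?thesis unfolding f_def 2 by (simp only: 1 3)
    qed
    then show "\<bar>2 * sin x * cos x\<bar> * f ((sin x)\<^sup>2) = 2 * \<bar>cos x\<bar> powr q"
      using p by (simp add: abs_mult powr_minus powr_diff field_simps)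
  qed
  also have "\<dots> = 2 * integral {0..pi/2} (\<lambda>x. \<bar>cos x\<bar> powr q)"
    by (simp add: S_def integral_open_interval_real)
  finally have half: "2 * integral {0..pi/2} (\<lambda>x. \<bar>cos x\<bar> powr q) = B" .
  have int: "(\<lambda>x. \<bar>cos x\<bar> powr q) integrable_on {a..b}" for a b
    using q by (intro integrable_continuous_real continuous_intros)
  \<comment> \<open>Evenness of the integrand accounts for the factor 2 left by the
    Jacobian.\<close>
  have "integral {-pi/2..0} (\<lambda>x. \<bar>cos x\<bar> powr q) = integral {0..pi/2} (\<lambda>x. \<bar>cos x\<bar> powr q)"
    using Henstock_Kurzweil_Integration.integral_reflect_real[of "pi/2" 0 "\<lambda>x. \<bar>cos x\<bar> powr q"] by simp
  moreover have "integral {-pi/2..0} (\<lambda>x. \<bar>cos x\<bar> powr q) + integral {0..pi/2} (\<lambda>x. \<bar>cos x\<bar> powr q)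
      = integral {-pi/2..pi/2} (\<lambda>x. \<bar>cos x\<bar> powr q)"
    by (intro Henstock_Kurzweil_Integration.integral_combine int) auto
  ultimately have "cos_moment q 0 = B"
    using half by (simp add: cos_moment_def)
  then show ?thesis by (simp add: B_def Beta_commute)
qed

text \<open>Integrate the derivative of \<open>cos x powr (q + 1) * sin ((2 * j + 1) * x)\<close>.\<close>

lemma cos_moment_Suc:
  assumes q: "0 < q"
  shows "(q + 2 * real j + 2) * cos_moment q (Suc j) = (q - 2 * real j) * cos_moment q j"
proof -
  \<comment> \<open>The odd frequency between \<open>2 * j\<close> and \<open>2 * j + 2\<close>: the
    addition formulas for \<open>a * x - x\<close> and \<open>a * x + x\<close> produce the two
    neighbouring moments.\<close>
  define a where "a = 2 * real j + 1"
  define F where "F x = \<bar>cos x\<bar> powr (q + 1) * sin (a * x)" for x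
  define G where "G x = (1/2) * ((q + 2 * real j + 2) * (\<bar>cos x\<bar> powr q * cos (2 * real (Suc j) * x)) -
     (q - 2 * real j) * (\<bar>cos x\<bar> powr q * cos (2 * real j * x)))" for x
  have "(G has_integral F (pi/2) - F (-pi/2)) {-pi/2..pi/2}"
  \<comment> \<open>The power is differentiated only where \<open>cos x > 0\<close>, hence the
    interior version. At both end points \<open>F\<close> vanishes because the cosine does.\<close>
  proof (rule fundamental_theorem_of_calculus_interior)
    show "continuous_on {-pi/2..pi/2} F"
      unfolding F_def using q by (intro continuous_intros) auto
    fix x :: real assume "x \<in> {-pi/2<..<pi/2}"
    then have c: "cos x > 0" by (intro cos_gt_zero_pi) auto
    have "((\<lambda>x. cos x powr (q + 1) * sin (a * x)) has_field_derivative
        (q + 1) * cos x powr q * (- sin x) * sin (a * x) + cos x powr (q + 1) * (a * cos (a * x))) (at x)"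
      using c by (auto intro!: derivative_eq_intros simp: powr_diff field_simps)
    also have "(q + 1) * cos x powr q * (- sin x) * sin (a * x) + cos x powr (q + 1) * (a * cos (a * x))
        = cos x powr q * (a * (cos x * cos (a * x)) - (q + 1) * (sin x * sin (a * x)))"
      using c by (simp add: powr_add algebra_simps)
    also have "\<dots> = G x"
    proof -
      have "2 * real (Suc j) * x = a * x + x" "2 * real j * x = a * x - x"
        by (simp_all add: a_def algebra_simps)
      note e = this[THEN arg_cong[where f = cos], unfolded cos_add cos_diff]
      have "q + 2 * real j + 2 = q + a + 1" "q - 2 * real j = q - a + 1"
        by (simp_all add: a_def)
      then show ?thesis
        unfolding G_def e abs_of_pos[OF c] by (simp add: field_simps)
    qed
    finally have "((\<lambda>x. cos x powr (q + 1) * sin (a * x)) has_vector_derivative G x) (at x)"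
      by (simp add: has_real_derivative_iff_has_vector_derivative)
    then show "(F has_vector_derivative G x) (at x)"
      by (rule has_vector_derivative_transform_within_open[where S = "{x. 0 < cos x}"])
         (use c in \<open>auto simp: F_def intro!: open_Collect_less continuous_intros\<close>)
  qed simp
  then have "(G has_integral 0) {-pi/2..pi/2}" using q by (simp add: F_def)
  moreover have "(G has_integral (1/2) * ((q + 2 * real j + 2) * cos_moment q (Suc j) - (q - 2 * real j) * cos_moment q j)) {-pi/2..pi/2}"
    unfolding G_def cos_moment_def
    by (intro has_integral_mult_right has_integral_diff integrable_integral integrable_continuous_real
          continuous_intros q)
  ultimately show ?thesis by (auto dest: has_integral_unique)
qed

text \<open>Induction along the two-term recurrence, started by the duplication formula. The bound
  on \<open>j\<close> keeps the second argument of \<open>Beta\<close> positive, so that no pole of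
  \<open>Gamma\<close> is met.\<close>

lemma cos_moment_eq_Beta:
  assumes q: "0 < q" and j: "real j < q / 2 + 1"
  shows "cos_moment q j = pi / (2 powr q * (q + 1) * Beta (q / 2 + real j + 1) (q / 2 - real j + 1))"
  using j
proof (induction j)
  case 0
  have D: "Gamma (q / 2 + 1/2) * Gamma (q / 2 + 1) = 2 powr (- q) * sqrt pi * Gamma (q + 1)"
    using Gamma_legendre_duplication_real[of "q / 2 + 1/2"] q by (simp add: algebra_simps)
  define g h where "g = Gamma (q / 2 + 1)" and "h = Gamma (q + 1)"
  have pos: "0 < g" "0 < h" using q by (auto simp: g_def h_def intro!: Gamma_real_pos)
  have "Gamma (q / 2 + 1/2) = Gamma (q / 2 + 1/2) * g / g" using pos by simp
  also have "Gamma (q / 2 + 1/2) * g = inverse (2 powr q) * sqrt pi * h"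
    using D by (simp only: g_def h_def powr_minus)
  finally have G: "Gamma (q / 2 + 1/2) = inverse (2 powr q) * sqrt pi * h / g" .
  have "Gamma (q + 2) = (q + 1) * h"
    using Gamma_plus1_pos_real[of "q + 1"] q by (simp add: h_def add.assoc)
  then have B: "Beta (q / 2 + 1) (q / 2 + 1) = g * g / ((q + 1) * h)"
    by (simp add: Beta_def g_def add.assoc)
  have "Beta (q / 2 + 1/2) (1/2) = inverse (2 powr q) * sqrt pi * h / g * sqrt pi / g"
    by (simp add: Beta_def G Gamma_one_half_real g_def add.assoc)
  also have "\<dots> = inverse (2 powr q) * (sqrt pi * sqrt pi) * h / (g * g)"
    by (simp only: divide_inverse inverse_mult_distrib mult_ac)
  also have "\<dots> = pi / (2 powr q * (q + 1) * Beta (q / 2 + 1) (q / 2 + 1))"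
    unfolding B using pos q by (simp add: divide_simps)
  finally show ?case by (simp add: cos_moment_0[OF q])
next
  case (Suc j)
  \<comment> \<open>Half the factors of the recurrence, which becomes
    \<open>a * cos_moment q (Suc j) = b * cos_moment q j\<close>; the reciprocals of the Beta values
    obey the same relation. The bound on \<open>Suc j\<close> gives \<open>b > 0\<close>.\<close>
  define a b where "a = q / 2 + real j + 1" and "b = q / 2 - real j"
  have pos: "a > 0" "b > 0" using Suc.prems q by (auto simp: a_def b_def)
  have IH: "cos_moment q j = pi / (2 powr q * (q + 1) * Beta a (b + 1))"
    using Suc by (simp add: a_def b_def)
  have "a * Beta a (b + 1) = b * Beta (a + 1) b"
  proof -
    have "a + (b + 1) = a + 1 + b" by simp
    then show ?thesis
      unfolding Beta_def by (simp only: Gamma_plus1_pos_real[OF pos(1)] Gamma_plus1_pos_real[OF pos(2)]) simp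
  qed
  moreover have "a * cos_moment q (Suc j) = b * cos_moment q j"
    using cos_moment_Suc[OF q, of j] by (simp add: a_def b_def field_simps)
  moreover have "c = r / (w * Y)"
    if "a * X = b * Y" "a * c = b * (r / (w * X))" "0 < w" "0 < Y" for X Y c r w :: real
  proof -
    have X: "X = b * Y / a" using that(1) pos by (simp add: field_simps)
    have "a * c = a * (r / (w * Y))" using that(2-) pos by (simp add: X)
    then show ?thesis by (rule mult_left_cancel[THEN iffD1, rotated]) (use pos in simp)
  qed
  ultimately have "cos_moment q (Suc j) = pi / (2 powr q * (q + 1) * Beta (a + 1) b)"
    using pos q Beta_pos[of "a + 1" b] unfolding IH by simp
  then show ?case by (simp add: a_def b_def algebra_simps)
qed

text \<open>Both sides gain the factor \<open>(2 * m + 1) / (2 * m + 2)\<close> when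
  \<open>m\<close> increases by one. This converts the constant term of the expansion of
  \<open>cos x ^ (2 * m)\<close> into the double factorials of the closed form.\<close>

lemma double_fact_quotient:
  "real (double_fact (2 * m - 1)) / real (double_fact (2 * m)) = real ((2 * m) choose m) / 2 ^ (2 * m)"
proof (induction m)
  case (Suc m)
  have d: "double_fact (2 * k) > 0" for k by (induction k) auto
  \<comment> \<open>The case split covers \<open>m = 0\<close>, where \<open>2 * m - 1\<close> is
    truncated to 0 and \<open>double_fact 0 = 1\<close>.\<close>
  have *: "double_fact (Suc (2 * m)) = Suc (2 * m) * double_fact (2 * m - 1)"
    by (cases m) auto
  have "Suc m * ((2 * Suc m) choose Suc m) = 2 * Suc (2 * m) * ((2 * m) choose m)"
  proof -
    have "Suc m * ((2 * Suc m) choose Suc m) = (2 * Suc m) * (Suc (2 * m) choose m)"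
      using Suc_times_binomial[of m "Suc (2 * m)"] by simp
    moreover have "Suc m * (Suc (2 * m) choose m) = Suc (2 * m) * ((2 * m) choose m)"
    proof -
      have "Suc (2 * m) choose m = Suc (2 * m) choose Suc m"
        using binomial_symmetric[of m "Suc (2 * m)"] by simp
      then show ?thesis using Suc_times_binomial[of m "2 * m"] by simp
    qed
    ultimately have "Suc m * (Suc m * ((2 * Suc m) choose Suc m)) = Suc m * (2 * Suc (2 * m) * ((2 * m) choose m))"
      by (simp add: algebra_simps)
    then show ?thesis by (simp only: mult_cancel1) simp
  qed
  then have c: "(real m + 1) * real ((2 * Suc m) choose Suc m) = 2 * (2 * real m + 1) * real ((2 * m) choose m)"
    by (simp only: of_nat_eq_iff[symmetric, where 'a = real] of_nat_mult) (simp add: algebra_simps)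
  have "real (double_fact (2 * Suc m - 1)) / real (double_fact (2 * Suc m)) =
      (2 * real m + 1) / (2 * real m + 2) * (real (double_fact (2 * m - 1)) / real (double_fact (2 * m)))"
    by (simp add: *) (simp add: algebra_simps)
  also have "\<dots> = (2 * real m + 1) / (2 * real m + 2) * (real ((2 * m) choose m) / 2 ^ (2 * m))"
    by (simp only: Suc)
  also have "\<dots> = ((real m + 1) * real ((2 * Suc m) choose Suc m)) / ((real m + 1) * (4 * 2 ^ (2 * m)))"
    unfolding c by (simp add: divide_simps) (simp add: algebra_simps)
  also have "\<dots> = real ((2 * Suc m) choose Suc m) / 2 ^ (2 * Suc m)"
    by (subst mult_divide_mult_cancel_left) (auto simp: algebra_simps)
  finally show ?case .
qed simp

section \<open>Closed form of the phase integral and its maximality at phase zero\<close>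

context
  fixes m N :: nat and q :: real
  assumes N: "0 < N" and q: "real N * q = 2 * (real m + 1)"
begin

lemma phase_exponent_pos: "0 < q"
  using q N by (smt (verit) mult_nonneg_nonpos of_nat_0_le_iff)

text \<open>From \<open>j * N \<le> m < m + 1 = N * q / 2\<close>. Every index occurring in the sums
  thus lies in the range of the Beta formula.\<close>

lemma index_less_half_exponent:
  assumes "j \<le> m div N"
  shows "real j < q / 2"
proof -
  have "j * N \<le> m" using assms N by (metis div_times_less_eq_dividend le_trans mult_le_mono1)
  then have "real j * real N \<le> real m" by (metis of_nat_le_iff of_nat_mult)
  then have "real N * real j < real N * (q / 2)" using q by (simp add: mult.commute)
  then show ?thesis using N by simp
qed

lemma phase_integral_0_eq:
  "phase_integral m N q 0 =
     real (double_fact (2 * m - 1)) / real (double_fact (2 * m)) * Beta (q / 2 + 1 / 2) (1 / 2)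
     + 2 * pi / (2 ^ (2 * m) * 2 powr q * (q + 1))
       * (\<Sum>j = 1..m div N. real ((2 * m) choose (m - j * N)) / Beta (q / 2 + real j + 1) (q / 2 - real j + 1))"
proof -
  have "(\<Sum>j = 1..m div N. real ((2 * m) choose (m - j * N)) * cos_moment q j * cos (2 * real j * 0))
      = (\<Sum>j = 1..m div N. pi / (2 powr q * (q + 1)) *
          (real ((2 * m) choose (m - j * N)) / Beta (q / 2 + real j + 1) (q / 2 - real j + 1)))"
  proof (intro sum.cong refl)
    fix j assume "j \<in> {1..m div N}"
    then have "real j < q / 2 + 1" using index_less_half_exponent[of j] by simp
    then show "real ((2 * m) choose (m - j * N)) * cos_moment q j * cos (2 * real j * 0) =
        pi / (2 powr q * (q + 1)) *
          (real ((2 * m) choose (m - j * N)) / Beta (q / 2 + real j + 1) (q / 2 - real j + 1))"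
      by (simp add: cos_moment_eq_Beta[OF phase_exponent_pos])
  qed
  also have "\<dots> = pi / (2 powr q * (q + 1)) * (\<Sum>j = 1..m div N.
          real ((2 * m) choose (m - j * N)) / Beta (q / 2 + real j + 1) (q / 2 - real j + 1))"
    by (simp only: sum_distrib_left)
  finally have "2 ^ (2 * m) * phase_integral m N q 0 = real ((2 * m) choose m) * cos_moment q 0 +
      2 * (pi / (2 powr q * (q + 1)) * (\<Sum>j = 1..m div N.
          real ((2 * m) choose (m - j * N)) / Beta (q / 2 + real j + 1) (q / 2 - real j + 1)))"
    using phase_integral_expansion[OF phase_exponent_pos N, of m 0] by simp
  moreover have "P = C / w * M + 2 * pi / (w * x * y) * T"
    if "w * P = C * M + 2 * (pi / (x * y) * T)" "w > 0" "x > 0" "y > 0" for w P C M x y T :: real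
    using that by (simp add: field_simps)
  ultimately show ?thesis
    unfolding double_fact_quotient cos_moment_0[OF phase_exponent_pos]
    using phase_exponent_pos by simp
qed

text \<open>The sign is read off the Beta formula. The index bound matters: once \<open>j\<close>
  exceeds \<open>q / 2\<close>, the factor \<open>q - 2 * j\<close> of the recurrence is negative
  and the next moment changes sign.\<close>

lemma cos_moment_pos:
  assumes "j \<le> m div N"
  shows "0 < cos_moment q j"
  using index_less_half_exponent[OF assms] phase_exponent_pos
  by (subst cos_moment_eq_Beta) (auto intro!: divide_pos_pos mult_pos_pos Beta_pos)

lemma phase_integral_le: "phase_integral m N q \<alpha> \<le> phase_integral m N q 0"
proof -
  have "(\<Sum>j = 1..m div N. real ((2 * m) choose (m - j * N)) * cos_moment q j * cos (2 * real j * \<alpha>))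
     \<le> (\<Sum>j = 1..m div N. real ((2 * m) choose (m - j * N)) * cos_moment q j * cos (2 * real j * 0))"
    using cos_moment_pos by (intro sum_mono mult_left_mono) (auto simp: less_imp_le)
  then have "2 ^ (2 * m) * phase_integral m N q \<alpha> \<le> 2 ^ (2 * m) * phase_integral m N q 0"
    unfolding phase_integral_expansion[OF phase_exponent_pos N] by simp
  then show ?thesis by simp
qed

text \<open>The mean term is strictly positive and the others are nonnegative. Strictness permits
  the cancellation of a power of this integral in the proof of sharpness.\<close>

lemma phase_integral_0_pos: "0 < phase_integral m N q 0"
proof -
  have "0 < 2 ^ (2 * m) * phase_integral m N q 0"
    unfolding phase_integral_expansion[OF phase_exponent_pos N]
    using cos_moment_pos
    by (intro add_pos_nonneg mult_pos_pos mult_nonneg_nonneg sum_nonneg) (auto simp: less_imp_le)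
  then show ?thesis by (simp add: zero_less_mult_iff)
qed

end

section \<open>Conjugate exponents and boundary values\<close>

text \<open>\<open>q\<close> is a real number, so the pair \<open>p = 1\<close>,
  \<open>q = \<infinity>\<close> is not represented; the exponents of the theorem satisfy
  \<open>p > 1\<close>.\<close>

definition conj_exponent :: "ereal \<Rightarrow> real \<Rightarrow> bool" where
  "conj_exponent p q \<longleftrightarrow>
     p = \<infinity> \<and> q = 1 \<or> (\<exists>r>1. p = ereal r \<and> 1 < q \<and> 1 / r + 1 / q = 1)"

lemma conj_exponent_ge_1: "conj_exponent p q \<Longrightarrow> 1 \<le> q"
  by (auto simp: conj_exponent_def)

lemma conj_exponent_inverse: "conj_exponent p q \<Longrightarrow> real_of_ereal (1 / p) = 1 - 1 / q"
  by (auto simp: conj_exponent_def one_ereal_def)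

text \<open>Young's inequality after dividing \<open>f\<close> and \<open>g\<close> by their norms.
  If one norm is zero, no such division is possible, but the product then vanishes almost
  everywhere.\<close>

lemma Holder_integral:
  fixes f g :: "'a \<Rightarrow> real"
  assumes pq: "1 < p" "1 < q" "1 / p + 1 / q = 1"
    and [measurable]: "f \<in> borel_measurable M" "g \<in> borel_measurable M"
    and f: "integrable M (\<lambda>x. \<bar>f x\<bar> powr p)" and g: "integrable M (\<lambda>x. \<bar>g x\<bar> powr q)"
  shows "integrable M (\<lambda>x. f x * g x)"
    and "\<bar>LINT x|M. f x * g x\<bar> \<le> (LINT x|M. \<bar>f x\<bar> powr p) powr (1 / p) * (LINT x|M. \<bar>g x\<bar> powr q) powr (1 / q)"
proof -
  define A B where "A = (LINT x|M. \<bar>f x\<bar> powr p)" and "B = (LINT x|M. \<bar>g x\<bar> powr q)"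
  have Y: "\<bar>f x * g x\<bar> \<le> \<bar>f x\<bar> powr p / p + \<bar>g x\<bar> powr q / q" for x
    using Youngs_inequality[OF pq, of "\<bar>f x\<bar>" "\<bar>g x\<bar>"] by (simp add: abs_mult)
  have Y0: "0 \<le> \<bar>f x\<bar> powr p / p + \<bar>g x\<bar> powr q / q" for x
    using pq by (intro add_nonneg_nonneg divide_nonneg_pos) auto
  show int: "integrable M (\<lambda>x. f x * g x)"
    by (rule Bochner_Integration.integrable_bound[where f = "\<lambda>x. \<bar>f x\<bar> powr p / p + \<bar>g x\<bar> powr q / q"])
       (use f g Y Y0 in auto)
  have AB: "0 \<le> A" "0 \<le> B" by (simp_all add: A_def B_def)
  have zero: "(LINT x|M. f x * g x) = 0" if "A = 0 \<or> B = 0"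
  proof -
    have "AE x in M. f x * g x = 0"
      using that
    proof
      assume "A = 0"
      then have "AE x in M. \<bar>f x\<bar> powr p = 0"
        using integral_nonneg_eq_0_iff_AE[OF f] by (simp add: A_def)
      then show ?thesis by eventually_elim auto
    next
      assume "B = 0"
      then have "AE x in M. \<bar>g x\<bar> powr q = 0"
        using integral_nonneg_eq_0_iff_AE[OF g] by (simp add: B_def)
      then show ?thesis by eventually_elim auto
    qed
    then show ?thesis by (rule integral_eq_zero_AE)
  qed
  show "\<bar>LINT x|M. f x * g x\<bar> \<le> A powr (1 / p) * B powr (1 / q)"
  proof (cases "A = 0 \<or> B = 0")
    case True
    then show ?thesis using zero by auto
  next
    case False
    define a b where "a = A powr (1 / p)" and "b = B powr (1 / q)"
    have pos: "0 < A" "0 < B" "0 < a" "0 < b" using False AB by (auto simp: a_def b_def)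
    have ap: "a powr p = A" and bq: "b powr q = B"
      using pq pos by (simp_all add: a_def b_def powr_powr)
    have le: "\<bar>f x * g x\<bar> \<le> a * b * (\<bar>f x\<bar> powr p / (p * A) + \<bar>g x\<bar> powr q / (q * B))" for x
    proof -
      have "(\<bar>f x\<bar> / a) * (\<bar>g x\<bar> / b) \<le> (\<bar>f x\<bar> / a) powr p / p + (\<bar>g x\<bar> / b) powr q / q"
        using pos by (intro Youngs_inequality[OF pq]) auto
      also have "\<dots> = \<bar>f x\<bar> powr p / (p * A) + \<bar>g x\<bar> powr q / (q * B)"
        using pos by (simp add: powr_divide ap bq mult_ac)
      finally show ?thesis using pos by (simp add: abs_mult field_simps)
    qed
    have "\<bar>LINT x|M. f x * g x\<bar> \<le> (LINT x|M. \<bar>f x * g x\<bar>)"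
      by (rule integral_abs_bound)
    also have "\<dots> \<le> (LINT x|M. a * b * (\<bar>f x\<bar> powr p / (p * A) + \<bar>g x\<bar> powr q / (q * B)))"
      using f g int by (intro integral_mono le integrable_abs) auto
    also have "\<dots> = a * b * (A / (p * A) + B / (q * B))"
      using f g by (simp add: A_def B_def)
    also have "A / (p * A) + B / (q * B) = 1"
      using pos pq by simp
    finally show ?thesis by (simp add: a_def b_def)
  qed
qed

lemma Lp_norm_nonneg: "0 \<le> Lp_norm p g"
proof -
  have "0 \<le> esssup lebesgue (\<lambda>t. ereal \<bar>g t\<bar>)"
  proof (cases "(\<lambda>t. ereal \<bar>g t\<bar>) \<in> borel_measurable lebesgue")
    case True
    have "esssup lebesgue (\<lambda>t::real. 0::ereal) \<le> esssup lebesgue (\<lambda>t. ereal \<bar>g t\<bar>)"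
      by (rule esssup_mono) auto
    then show ?thesis by (simp add: esssup_const)
  \<comment> \<open>By convention the essential supremum of a non-measurable function is
    \<open>\<infinity>\<close>.\<close>
  qed (simp add: esssup_non_measurable top_ereal_def)
  then show ?thesis by (simp add: Lp_norm_def real_of_ereal_pos)
qed

lemma Lp_infinity_AE_bound:
  assumes "Lp_fun \<infinity> g"
  shows "AE t in lebesgue. \<bar>g t\<bar> \<le> Lp_norm \<infinity> g"
proof -
  define s where "s = esssup lebesgue (\<lambda>t. ereal \<bar>g t\<bar>)"
  have "s < \<infinity>" using assms by (simp add: Lp_fun_def s_def)
  have "AE t in lebesgue. ereal \<bar>g t\<bar> \<le> s" unfolding s_def by (rule esssup_AE)
  then show ?thesis
  proof eventually_elim
    case (elim t)
    with \<open>s < \<infinity>\<close> show ?case by (cases s) (auto simp: Lp_norm_def s_def)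
  qed
qed

lemma Lp_pairing:
  assumes pq: "conj_exponent p q" and g: "Lp_fun p g"
    and k: "k \<in> borel_measurable lebesgue" and kq: "integrable lebesgue (\<lambda>t. \<bar>k t\<bar> powr q)"
  shows "integrable lebesgue (\<lambda>t. g t * k t)"
    and "\<bar>LINT t|lebesgue. g t * k t\<bar> \<le> Lp_norm p g * (LINT t|lebesgue. \<bar>k t\<bar> powr q) powr (1 / q)"
proof -
  have gm: "g \<in> borel_measurable lebesgue" using g by (simp add: Lp_fun_def)
  have "integrable lebesgue (\<lambda>t. g t * k t) \<and>
    \<bar>LINT t|lebesgue. g t * k t\<bar> \<le> Lp_norm p g * (LINT t|lebesgue. \<bar>k t\<bar> powr q) powr (1 / q)"
    using pq unfolding conj_exponent_def
  proof (elim disjE conjE exE)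
    assume p: "p = \<infinity>" and q: "q = 1"
    have k1: "integrable lebesgue (\<lambda>t. \<bar>k t\<bar>)" using kq by (simp add: q)
    have AE: "AE t in lebesgue. \<bar>g t * k t\<bar> \<le> Lp_norm p g * \<bar>k t\<bar>"
      using Lp_infinity_AE_bound[OF g[unfolded p]] unfolding p
      by eventually_elim (auto simp: abs_mult intro: mult_right_mono)
    have int: "integrable lebesgue (\<lambda>t. g t * k t)"
      using gm k AE Lp_norm_nonneg[of p g]
      by (intro Bochner_Integration.integrable_bound[OF integrable_mult_right[OF k1, of "Lp_norm p g"]]) (auto simp: abs_mult)
    have "\<bar>LINT t|lebesgue. g t * k t\<bar> \<le> (LINT t|lebesgue. \<bar>g t * k t\<bar>)"
      by (rule integral_abs_bound)
    also have "\<dots> \<le> (LINT t|lebesgue. Lp_norm p g * \<bar>k t\<bar>)"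
      using AE by (intro integral_mono_AE integrable_abs int integrable_mult_right k1)
    finally show ?thesis using int by (simp add: q)
  next
    fix r assume r: "1 < r" "p = ereal r" "1 < q" "1 / r + 1 / q = 1"
    then have "integrable lebesgue (\<lambda>t. \<bar>g t\<bar> powr r)" using g by (simp add: Lp_fun_def)
    from Holder_integral[OF r(1,3,4) gm k this kq] show ?thesis
      by (simp add: Lp_norm_def r(2))
  qed
  then show "integrable lebesgue (\<lambda>t. g t * k t)"
    and "\<bar>LINT t|lebesgue. g t * k t\<bar> \<le> Lp_norm p g * (LINT t|lebesgue. \<bar>k t\<bar> powr q) powr (1 / q)"
    by auto
qed

text \<open>Equality case of Hoelder: for \<open>g = sgn k * \<bar>k\<bar> powr (q - 1)\<close> the
  product \<open>g * k\<close> is \<open>\<bar>k\<bar> powr q\<close>, and for finite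
  \<open>p\<close> so is the \<open>p\<close>-th power of \<open>\<bar>g\<bar>\<close>; for
  \<open>p = \<infinity>\<close> the function is the sign of \<open>k\<close>. An upper bound on the
  norm is enough for testing constants.\<close>

lemma Lp_extremal:
  assumes pq: "conj_exponent p q"
    and k: "k \<in> borel_measurable lebesgue" and kq: "has_bochner_integral lebesgue (\<lambda>t. \<bar>k t\<bar> powr q) I"
    and I: "0 < I"
  obtains g where "Lp_fun p g" "Lp_norm p g \<le> I powr (1 - 1 / q)" "(LINT t|lebesgue. g t * k t) = I"
proof
  define g where "g t = sgn (k t) * \<bar>k t\<bar> powr (q - 1)" for t
  have q: "1 \<le> q" by (rule conj_exponent_ge_1[OF pq])
  have "k \<in> lebesgue \<rightarrow>\<^sub>M borel" by (rule k)
  then have gm: "g \<in> borel_measurable lebesgue"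
    unfolding g_def by measurable
  have "g t * k t = \<bar>k t\<bar> powr q" for t
  proof (cases "k t = 0")
    case False
    have "g t * k t = \<bar>k t\<bar> * \<bar>k t\<bar> powr (q - 1)"
      by (simp add: g_def abs_sgn mult_ac)
    also have "\<dots> = \<bar>k t\<bar> powr q"
      using False powr_add[of "\<bar>k t\<bar>" 1 "q - 1"] by simp
    finally show ?thesis .
  qed simp
  then show "(LINT t|lebesgue. g t * k t) = I"
    using kq by (simp add: has_bochner_integral_iff)
  have "Lp_fun p g \<and> Lp_norm p g \<le> I powr (1 - 1 / q)"
    using pq unfolding conj_exponent_def
  proof (elim disjE conjE exE)
    assume p: "p = \<infinity>" and q: "q = 1"
    define s where "s = esssup lebesgue (\<lambda>t. ereal \<bar>g t\<bar>)"
    have "\<bar>g t\<bar> \<le> 1" for t by (simp add: g_def q abs_mult sgn_if)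
    then have s: "s \<le> 1" unfolding s_def using gm
      by (intro esssup_I) (auto simp: one_ereal_def)
    then have "s < \<infinity>" by (cases s) (auto simp: one_ereal_def)
    moreover have "real_of_ereal s \<le> 1" using s by (cases s) (auto simp: one_ereal_def)
    \<comment> \<open>The bound is \<open>I powr 0\<close>, which equals 1 because
      \<open>I > 0\<close>; \<open>0 powr 0\<close> would be 0.\<close>
    ultimately show ?thesis using gm I by (simp add: p q Lp_fun_def Lp_norm_def s_def)
  next
    fix r assume r: "1 < r" "p = ereal r" "1 < q" "1 / r + 1 / q = 1"
    have "(q - 1) * r = q" using r by (simp add: field_simps)
    then have "\<bar>g t\<bar> powr r = \<bar>k t\<bar> powr q" for t
      by (cases "k t = 0") (simp_all add: g_def abs_mult powr_powr)
    moreover have "1 / r = 1 - 1 / q" using r(4) by simp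
    ultimately show ?thesis
      using kq gm by (simp add: r(2) Lp_fun_def Lp_norm_def has_bochner_integral_iff)
  qed
  then show "Lp_fun p g" "Lp_norm p g \<le> I powr (1 - 1 / q)" by auto
qed

section \<open>Poisson integrals and analytic functions with given real part\<close>

lemma of_real_neq_upper: "0 < Im z \<Longrightarrow> z - of_real t \<noteq> 0"
  by (metis Im_complex_of_real less_irrefl right_minus_eq)

text \<open>The kernel is bounded and integrable, so its \<open>q\<close>-th power is integrable for
  every \<open>q \<ge> 1\<close> and Hoelder applies.\<close>

lemma Lp_poisson_integrable:
  assumes pq: "conj_exponent p q" and g: "Lp_fun p g" and z: "0 < Im z"
  shows "integrable lebesgue (\<lambda>t. g t / (cmod (z - of_real t))\<^sup>2)"
proof -
  define k where "k t = 1 / (cmod (z - of_real t))\<^sup>2" for t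
  have km: "k \<in> borel_measurable lebesgue"
    unfolding k_def using of_real_neq_upper[OF z]
    by (intro borel_measurable_lebesgue_of_continuous continuous_intros) auto
  have k: "0 < k t" "k t \<le> 1 / (Im z)\<^sup>2" for t
    using of_real_neq_upper[OF z, of t] Im_le_cmod_diff_of_real[of z t] z
    by (auto simp: k_def intro!: divide_left_mono power_mono mult_pos_pos)
  have le: "\<bar>k t\<bar> powr q \<le> (1 / (Im z)\<^sup>2) powr (q - 1) * k t" for t
  proof -
    have "k t powr q = k t powr (q - 1) * k t"
      using k(1)[of t] powr_add[of "k t" "q - 1" 1] by simp
    also have "\<dots> \<le> (1 / (Im z)\<^sup>2) powr (q - 1) * k t"
      using k[of t] conj_exponent_ge_1[OF pq] by (intro mult_right_mono powr_mono2) auto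
    finally show ?thesis using k(1)[of t] by simp
  qed
  have "integrable lebesgue k"
    unfolding k_def[abs_def] by (rule poisson_kernel_integrable[OF z])
  then have "integrable lebesgue (\<lambda>t. (1 / (Im z)\<^sup>2) powr (q - 1) * k t)" by simp
  then have "integrable lebesgue (\<lambda>t. \<bar>k t\<bar> powr q)"
    by (rule Bochner_Integration.integrable_bound)
       (use km le k(1) in \<open>auto simp: abs_mult less_imp_le intro!: AE_I2\<close>)
  from Lp_pairing(1)[OF pq g km this] show ?thesis by (simp add: k_def)
qed

definition poisson_integral :: "(real \<Rightarrow> real) \<Rightarrow> complex \<Rightarrow> real" where
  "poisson_integral g z = 1 / pi * (LINT t|lebesgue. Im z * g t / ((Re z - t)\<^sup>2 + (Im z)\<^sup>2))"

context
  fixes g :: "real \<Rightarrow> real"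
  assumes g: "g \<in> borel_measurable lebesgue"
    and int: "\<And>z. 0 < Im z \<Longrightarrow> integrable lebesgue (\<lambda>t. g t / (cmod (z - of_real t))\<^sup>2)"
begin

text \<open>The kernel difference is \<open>(z - w) / ((w - t) * (z - t))\<close>; by
  \<open>a * b \<le> a^2 + b^2\<close> it is dominated by the Poisson kernels at both
  points.\<close>

lemma cauchy_diff_integrable:
  assumes z: "0 < Im z" and w: "0 < Im w"
  shows "integrable lebesgue (\<lambda>t. of_real (g t) * (1 / (w - of_real t) - 1 / (z - of_real t)))"
proof (rule Bochner_Integration.integrable_bound)
  show "integrable lebesgue (\<lambda>t. cmod (z - w) * (\<bar>g t\<bar> / (cmod (w - of_real t))\<^sup>2 + \<bar>g t\<bar> / (cmod (z - of_real t))\<^sup>2))"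
    using integrable_abs[OF int[OF z]] integrable_abs[OF int[OF w]]
    by (intro integrable_mult_right Bochner_Integration.integrable_add) (simp_all add: abs_divide)
  have [measurable]: "(\<lambda>t. 1 / (w - of_real t) - 1 / (z - of_real t)) \<in> borel_measurable lebesgue"
    using of_real_neq_upper[OF z] of_real_neq_upper[OF w]
    by (intro borel_measurable_lebesgue_of_continuous continuous_intros) auto
  have [measurable]: "(\<lambda>t. complex_of_real (g t)) \<in> borel_measurable lebesgue"
    using g by measurable
  show "(\<lambda>t. of_real (g t) * (1 / (w - of_real t) - 1 / (z - of_real t))) \<in> borel_measurable lebesgue"
    by measurable
  show "AE t in lebesgue. cmod (of_real (g t) * (1 / (w - of_real t) - 1 / (z - of_real t)))
      \<le> norm (cmod (z - w) * (\<bar>g t\<bar> / (cmod (w - of_real t))\<^sup>2 + \<bar>g t\<bar> / (cmod (z - of_real t))\<^sup>2))"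
  proof (rule AE_I2)
    fix t
    define a b where "a = 1 / cmod (w - of_real t)" and "b = 1 / cmod (z - of_real t)"
    have "1 / (w - of_real t) - 1 / (z - of_real t) = (z - w) * (1 / (w - of_real t)) * (1 / (z - of_real t))"
      using of_real_neq_upper[OF z, of t] of_real_neq_upper[OF w, of t] by (simp add: field_simps)
    then have "cmod (of_real (g t) * (1 / (w - of_real t) - 1 / (z - of_real t))) = \<bar>g t\<bar> * (cmod (z - w) * a * b)"
      by (simp only: norm_mult) (simp add: norm_divide a_def b_def)
    also have "\<dots> = cmod (z - w) * (\<bar>g t\<bar> * (a * b))" by (simp add: mult_ac)
    also have "\<dots> \<le> cmod (z - w) * (\<bar>g t\<bar> * (a\<^sup>2 + b\<^sup>2))"
    proof -
      have "0 \<le> a * b" by (simp add: a_def b_def)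
      then have "a * b \<le> a\<^sup>2 + b\<^sup>2" using sum_squares_bound[of a b] by simp
      then show ?thesis by (intro mult_left_mono) auto
    qed
    also have "\<dots> \<le> norm (cmod (z - w) * (\<bar>g t\<bar> / (cmod (w - of_real t))\<^sup>2 + \<bar>g t\<bar> / (cmod (z - of_real t))\<^sup>2))"
      by (simp add: a_def b_def power_divide field_simps)
    finally show "cmod (of_real (g t) * (1 / (w - of_real t) - 1 / (z - of_real t)))
      \<le> norm (cmod (z - w) * (\<bar>g t\<bar> / (cmod (w - of_real t))\<^sup>2 + \<bar>g t\<bar> / (cmod (z - of_real t))\<^sup>2))" .
  qed
qed

text \<open>Change of base point: a function normalised at \<open>\<i>\<close> can thereby be
  expanded around any other point.\<close>

lemma cauchy_diff_add:
  assumes "0 < Im z" "0 < Im w" "0 < Im v"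
  shows "cauchy_diff g v w = cauchy_diff g v z + cauchy_diff g z w"
  unfolding cauchy_diff_def
  by (subst Bochner_Integration.integral_add[symmetric, OF cauchy_diff_integrable cauchy_diff_integrable])
     (simp_all add: assms algebra_simps)

text \<open>The imaginary part of \<open>1 / (w - t)\<close> is
  \<open>- Im w / (cmod (w - t))^2\<close>; the factor \<open>\<i> / pi\<close> moves it to the real
  part with the sign and normalisation of the Poisson kernel.\<close>

lemma Re_cauchy_diff:
  assumes z: "0 < Im z" and w: "0 < Im w"
  shows "Re (\<i> / of_real pi * cauchy_diff g z w) = poisson_integral g w - poisson_integral g z"
proof -
  have P: "poisson_integral g v = 1 / pi * (LINT t|lebesgue. Im v * (g t / (cmod (v - of_real t))\<^sup>2))" for v
    by (simp add: poisson_integral_def cmod_power2)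
  have "Im (cauchy_diff g z w) = (LINT t|lebesgue. Im (of_real (g t) * (1 / (w - of_real t) - 1 / (z - of_real t))))"
    unfolding cauchy_diff_def by (rule integral_Im[OF cauchy_diff_integrable[OF z w], symmetric])
  also have "\<dots> = (LINT t|lebesgue. Im z * (g t / (cmod (z - of_real t))\<^sup>2) - Im w * (g t / (cmod (w - of_real t))\<^sup>2))"
    by (intro Bochner_Integration.integral_cong refl)
       (simp add: Im_divide cmod_power2 right_diff_distrib mult_ac)
  also have "\<dots> = (LINT t|lebesgue. Im z * (g t / (cmod (z - of_real t))\<^sup>2)) - (LINT t|lebesgue. Im w * (g t / (cmod (w - of_real t))\<^sup>2))"
    by (intro Bochner_Integration.integral_diff integrable_mult_right int z w)
  also have "\<dots> = pi * (poisson_integral g z - poisson_integral g w)"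
    unfolding P by (simp add: field_simps)
  finally have "Im (cauchy_diff g z w) = pi * (poisson_integral g z - poisson_integral g w)" .
  moreover have "Re (\<i> / of_real pi * c) = - Im c / pi" for c
    by (simp add: Re_divide power2_eq_square)
  ultimately show ?thesis by simp
qed

text \<open>On the disc of radius \<open>Im z\<close> the difference of \<open>f\<close> and the
  Cauchy integral has constant real part, hence is constant, and a derivative of positive order does
  not see it.\<close>

lemma higher_deriv_analytic_of_Re_poisson:
  assumes f: "f analytic_on upper_half_plane"
    and Re: "\<And>z. 0 < Im z \<Longrightarrow> Re (f z) = poisson_integral g z"
    and z: "0 < Im z" and n: "0 < n"
  shows "(deriv ^^ n) f z = fact n * (\<i> / of_real pi) * (-1) ^ n * (LINT t|lebesgue. of_real (g t) / (z - of_real t) ^ Suc n)"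
proof -
  define B where "B = ball z (Im z)"
  have pos: "0 < Im w" if "w \<in> B" for w
    using that abs_Im_le_cmod[of "z - w"] by (simp add: B_def dist_norm)
  have zB: "z \<in> B" using z by (simp add: B_def)
  define h where "h w = f w - \<i> / of_real pi * cauchy_diff g z w" for w
  have "(\<lambda>w. 0 + 1 * cauchy_diff g z w) holomorphic_on B"
    unfolding B_def by (rule higher_deriv_cauchy_diff(1)[OF g z int[OF z], where c = 0 and b = 1]) simp
  moreover have "f holomorphic_on B"
    by (rule analytic_imp_holomorphic[OF analytic_on_subset[OF f]]) (use pos in \<open>auto simp: upper_half_plane_def\<close>)
  ultimately have "h holomorphic_on B"
    unfolding h_def by (auto intro!: holomorphic_intros)
  moreover have "Re (h w) = poisson_integral g z" if "w \<in> B" for w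
    using Re[OF pos[OF that]] Re_cauchy_diff[OF z pos[OF that]] unfolding h_def by simp
  ultimately have "h constant_on B"
    by (intro holomorphic_Re_const_imp_constant_on) (auto simp: B_def)
  then obtain c where "h w = c" if "w \<in> B" for w by (auto simp: constant_on_def)
  then have "f w = c + \<i> / of_real pi * cauchy_diff g z w" if "w \<in> ball z (Im z)" for w
    using that by (auto simp: h_def B_def algebra_simps)
  from higher_deriv_cauchy_diff(2)[OF g z int[OF z] this n] show ?thesis .
qed

lemma exists_analytic_Re_poisson:
  obtains f where "f analytic_on upper_half_plane" "\<And>z. 0 < Im z \<Longrightarrow> Re (f z) = poisson_integral g z"
proof
  \<comment> \<open>The real constant is the value lost by subtracting the kernel at
    \<open>\<i>\<close>; with it the real parts agree exactly.\<close>
  define f where "f w = of_real (poisson_integral g \<i>) + \<i> / of_real pi * cauchy_diff g \<i> w" for w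
  show "f analytic_on upper_half_plane"
    unfolding analytic_on_def
  proof
    fix z assume "z \<in> upper_half_plane"
    then have z: "0 < Im z" by (simp add: upper_half_plane_def)
    have "f holomorphic_on ball z (Im z)"
    proof (rule higher_deriv_cauchy_diff(1)[OF g z int[OF z]])
      fix w assume "w \<in> ball z (Im z)"
      then have "0 < Im w" using abs_Im_le_cmod[of "z - w"] by (simp add: dist_norm)
      then show "f w = (of_real (poisson_integral g \<i>) + \<i> / of_real pi * cauchy_diff g \<i> z) + \<i> / of_real pi * cauchy_diff g z w"
        using cauchy_diff_add[OF z, of w \<i>] by (simp add: f_def algebra_simps)
    qed
    with z show "\<exists>e>0. f holomorphic_on ball z e" by blast
  qed
  show "Re (f z) = poisson_integral g z" if "0 < Im z" for z
    using Re_cauchy_diff[of \<i> z] that unfolding f_def by simp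
qed

end

section \<open>The sharp constant\<close>

context
  fixes m n :: nat and p :: ereal and q :: real
  assumes n: "1 \<le> n" and q: "real (n + 1) * q = 2 * (real m + 1)" and pq: "conj_exponent p q"
begin

lemma hp_higher_deriv:
  assumes f: "f analytic_on upper_half_plane" and hp: "hp_with_boundary p (\<lambda>z. Re (f z)) g" and z: "0 < Im z"
  shows "(deriv ^^ n) f z = fact n * (\<i> / of_real pi) * (-1) ^ n * (LINT t|lebesgue. of_real (g t) / (z - of_real t) ^ Suc n)"
proof (rule higher_deriv_analytic_of_Re_poisson)
  have Lp: "Lp_fun p g" using hp by (simp add: hp_with_boundary_def)
  then show "g \<in> borel_measurable lebesgue" by (simp add: Lp_fun_def)
  show "integrable lebesgue (\<lambda>t. g t / (cmod (w - of_real t))\<^sup>2)" if "0 < Im w" for w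
    by (rule Lp_poisson_integrable[OF pq Lp that])
  show "Re (f w) = poisson_integral g w" if "0 < Im w" for w
  proof -
    have "Re (f (Complex (Re w) (Im w))) = 1 / pi * (LINT t|lebesgue. Im w * g t / ((Re w - t)\<^sup>2 + (Im w)\<^sup>2))"
      using hp that unfolding hp_with_boundary_def by blast
    then show ?thesis by (simp add: poisson_integral_def)
  qed
qed (use f z n in auto)

lemma norm_higher_deriv:
  assumes "f analytic_on upper_half_plane" "hp_with_boundary p (\<lambda>z. Re (f z)) g" "0 < Im z"
  shows "cmod ((deriv ^^ n) f z) = fact n / pi * cmod (LINT t|lebesgue. of_real (g t) / (z - of_real t) ^ Suc n)"
  unfolding hp_higher_deriv[OF assms] by (simp add: norm_mult norm_divide norm_power)

lemma Cauchy_kernel_integrable: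
  assumes Lp: "Lp_fun p g" and z: "0 < Im z"
  shows "integrable lebesgue (\<lambda>t. of_real (g t) / (z - of_real t) ^ Suc n)"
proof -
  \<comment> \<open>\<open>n \<ge> 1\<close> enters here: the kernel decays at least like
    \<open>1 / t^2\<close>.\<close>
  have "Suc n = (n - 1) + 2" using n by simp
  then show ?thesis
    using integrable_over_power(1)[OF _ z Lp_poisson_integrable[OF pq Lp z], of "n - 1"] Lp
    by (simp only: Lp_fun_def)
qed

text \<open>Since \<open>g\<close> is real, only the real part of the rotated kernel pairs with it.
  This reduces the complex extremal problem to duality between real functions.\<close>

lemma Re_rotated_Cauchy_integral:
  assumes Lp: "Lp_fun p g" and z: "0 < Im z"
  shows "Re (c * (LINT t|lebesgue. of_real (g t) / (z - of_real t) ^ Suc n))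
     = (LINT t|lebesgue. g t * Re (c / (z - of_real t) ^ Suc n))"
proof -
  have int: "integrable lebesgue (\<lambda>t. c * (of_real (g t) / (z - of_real t) ^ Suc n))"
    by (intro integrable_mult_right Cauchy_kernel_integrable[OF Lp z])
  have "Re (c * (LINT t|lebesgue. of_real (g t) / (z - of_real t) ^ Suc n))
      = Re (LINT t|lebesgue. c * (of_real (g t) / (z - of_real t) ^ Suc n))"
    by (simp only: integral_mult_right_zero)
  also have "\<dots> = (LINT t|lebesgue. Re (c * (of_real (g t) / (z - of_real t) ^ Suc n)))"
    by (rule integral_Re[OF int, symmetric])
  also have "\<dots> = (LINT t|lebesgue. g t * Re (c / (z - of_real t) ^ Suc n))"
  proof (rule Bochner_Integration.integral_cong[OF refl])
    fix t
    have "c * (of_real (g t) / (z - of_real t) ^ Suc n) = of_real (g t) * (c / (z - of_real t) ^ Suc n)"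
      by simp
    then show "Re (c * (of_real (g t) / (z - of_real t) ^ Suc n)) = g t * Re (c / (z - of_real t) ^ Suc n)"
      by (simp only: Re_complex_of_real times_complex.simps Im_complex_of_real)
  qed
  finally show ?thesis .
qed

lemma rotated_kernel_measurable:
  "0 < Im z \<Longrightarrow> (\<lambda>t. Re (c / (z - of_real t) ^ Suc n)) \<in> borel_measurable lebesgue"
  using of_real_neq_upper[of z]
  by (intro borel_measurable_lebesgue_of_continuous continuous_intros) auto

lemma rotated_kernel_integral:
  "0 < Im z \<Longrightarrow> has_bochner_integral lebesgue
     (\<lambda>t. \<bar>Re (cis (real (n + 1) * (pi / 2) - \<alpha>) / (z - of_real t) ^ Suc n)\<bar> powr q)
     (phase_integral m (n + 1) q \<alpha> / Im z ^ (2 * m + 1))"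
  using kernel_power_integral[OF _ _ q, of z \<alpha>] by simp

lemma sharp_constant_phase_integral:
  "sharp_constant n p (fact n / pi * phase_integral m (n + 1) q 0 powr (1 / q))"
proof -
  define \<Phi> where "\<Phi> = phase_integral m (n + 1) q"
  have q1: "1 \<le> q" by (rule conj_exponent_ge_1[OF pq])
  have \<Phi>0: "0 < \<Phi> 0" unfolding \<Phi>_def by (rule phase_integral_0_pos[OF _ q]) simp
  have \<Phi>_le: "\<Phi> \<alpha> \<le> \<Phi> 0" for \<alpha> unfolding \<Phi>_def by (rule phase_integral_le[OF _ q]) simp
  have \<Phi>_nonneg: "0 \<le> \<Phi> \<alpha>" for \<alpha>
    unfolding \<Phi>_def phase_integral_def using q1
    by (intro integral_nonneg integrable_continuous_real continuous_intros) auto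
  have "admissible_constant n p (fact n / pi * \<Phi> 0 powr (1 / q))"
    unfolding admissible_constant_def
  proof (intro allI impI ballI)
    fix f g z
    assume f: "f analytic_on upper_half_plane" and hp: "hp_with_boundary p (\<lambda>z. Re (f z)) g"
      and "z \<in> upper_half_plane"
    then have z: "0 < Im z" and Lp: "Lp_fun p g"
      by (auto simp: upper_half_plane_def hp_with_boundary_def)
    define W where "W = (LINT t|lebesgue. of_real (g t) / (z - of_real t) ^ Suc n)"
    \<comment> \<open>Chosen such that \<open>(n + 1) * pi / 2 - \<alpha> = - Arg W\<close>, the
      rotation that turns \<open>W\<close> into its modulus.\<close>
    define \<alpha> where "\<alpha> = real (n + 1) * (pi / 2) + Arg W"
    have "cmod W = Re (cis (- Arg W) * W)"
    proof -
      have "cis (- Arg W) * W = cis (- Arg W) * (of_real (cmod W) * cis (Arg W))"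
        by (metis rcis_cmod_Arg rcis_def)
      also have "\<dots> = of_real (cmod W) * (cis (- Arg W) * cis (Arg W))" by (simp only: mult_ac)
      finally show ?thesis by (simp add: cis_mult)
    qed
    also have "- Arg W = real (n + 1) * (pi / 2) - \<alpha>" by (simp add: \<alpha>_def)
    also have "Re (cis (real (n + 1) * (pi / 2) - \<alpha>) * W)
        = (LINT t|lebesgue. g t * Re (cis (real (n + 1) * (pi / 2) - \<alpha>) / (z - of_real t) ^ Suc n))"
      unfolding W_def by (rule Re_rotated_Cauchy_integral[OF Lp z])
    also have "\<dots> \<le> Lp_norm p g * (\<Phi> \<alpha> / Im z ^ (2 * m + 1)) powr (1 / q)"
    proof -
      note hb = rotated_kernel_integral[OF z, of \<alpha>]
      note Lp_pairing(2)[OF pq Lp rotated_kernel_measurable[OF z] integrable.intros[OF hb]]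
      then show ?thesis
        unfolding has_bochner_integral_integral_eq[OF hb] \<Phi>_def[symmetric]
        by (rule order_trans[OF abs_ge_self])
    qed
    also have "\<dots> \<le> Lp_norm p g * (\<Phi> 0 / Im z ^ (2 * m + 1)) powr (1 / q)"
      using z q1 \<Phi>_le \<Phi>_nonneg
      by (intro mult_left_mono powr_mono2 divide_right_mono Lp_norm_nonneg) auto
    also have "(\<Phi> 0 / Im z ^ (2 * m + 1)) powr (1 / q)
        = \<Phi> 0 powr (1 / q) / Im z powr (real n + real_of_ereal (1 / p))"
    proof -
      have "(Im z ^ (2 * m + 1)) powr (1 / q) = Im z powr (real (2 * m + 1) * (1 / q))"
        unfolding powr_realpow[OF z, symmetric] by (rule powr_powr)
      \<comment> \<open>From \<open>(2 * m + 2) / q = n + 1\<close> and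
        \<open>1 / p = 1 - 1 / q\<close>.\<close>
      also have "real (2 * m + 1) * (1 / q) = real n + real_of_ereal (1 / p)"
        unfolding conj_exponent_inverse[OF pq] using q q1 by (simp add: field_simps)
      finally show ?thesis using z \<Phi>0 by (simp add: powr_divide)
    qed
    finally have "fact n / pi * cmod W \<le> fact n / pi * (Lp_norm p g * (\<Phi> 0 powr (1 / q) / Im z powr (real n + real_of_ereal (1 / p))))"
      by (intro mult_left_mono) auto
    then show "cmod ((deriv ^^ n) f z)
        \<le> fact n / pi * \<Phi> 0 powr (1 / q) / Im z powr (real n + real_of_ereal (1 / p)) * Lp_norm p g"
      unfolding norm_higher_deriv[OF f hp z] W_def by (simp add: mult_ac)
  qed
  moreover have "fact n / pi * \<Phi> 0 powr (1 / q) \<le> C" if C: "admissible_constant n p C" for C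
  proof -
    \<comment> \<open>Testing at one point suffices; at \<open>\<i>\<close> all powers of the
      imaginary part are 1.\<close>
    have i: "0 < Im \<i>" by simp
    define c where "c = cis (real (n + 1) * (pi / 2) - 0)"
    define k where "k t = Re (c / (\<i> - of_real t) ^ Suc n)" for t
    have "has_bochner_integral lebesgue (\<lambda>t. \<bar>k t\<bar> powr q) (\<Phi> 0)"
      using rotated_kernel_integral[OF i, of 0] by (simp add: k_def c_def \<Phi>_def)
    then obtain g where Lp: "Lp_fun p g" and norm: "Lp_norm p g \<le> \<Phi> 0 powr (1 - 1 / q)"
      and gk: "(LINT t|lebesgue. g t * k t) = \<Phi> 0"
      using Lp_extremal[OF pq _ _ \<Phi>0] rotated_kernel_measurable[OF i, of c]
      unfolding k_def by blast
    have gm: "g \<in> borel_measurable lebesgue" using Lp by (simp add: Lp_fun_def)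
    obtain f where f: "f analytic_on upper_half_plane"
      and Re: "\<And>z. 0 < Im z \<Longrightarrow> Re (f z) = poisson_integral g z"
      using exists_analytic_Re_poisson[OF gm Lp_poisson_integrable[OF pq Lp]] by blast
    have hp: "hp_with_boundary p (\<lambda>z. Re (f z)) g"
      using Lp Re by (simp add: hp_with_boundary_def poisson_integral_def)
    define W where "W = (LINT t|lebesgue. of_real (g t) / (\<i> - of_real t) ^ Suc n)"
    have "\<Phi> 0 = Re (c * W)"
      unfolding W_def Re_rotated_Cauchy_integral[OF Lp i] using gk by (simp only: k_def)
    also have "\<dots> \<le> cmod W"
      using complex_Re_le_cmod[of "c * W"] by (simp add: norm_mult c_def)
    finally have "fact n / pi * \<Phi> 0 \<le> fact n / pi * cmod W"
      by (intro mult_left_mono) auto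
    also have "\<dots> = cmod ((deriv ^^ n) f \<i>)"
      unfolding W_def by (rule norm_higher_deriv[OF f hp i, symmetric])
    also have "\<dots> \<le> C / Im \<i> powr (real n + real_of_ereal (1 / p)) * Lp_norm p g"
      by (rule C[unfolded admissible_constant_def, rule_format, OF f hp]) (simp add: upper_half_plane_def)
    finally have le: "fact n / pi * \<Phi> 0 \<le> C * Lp_norm p g" by simp
    moreover have "0 < fact n / pi * \<Phi> 0" using \<Phi>0 by simp
    ultimately have "0 < C * Lp_norm p g" by linarith
    \<comment> \<open>The sign of \<open>C\<close> is needed before the upper bound on the norm of
      \<open>g\<close> can be inserted on the right.\<close>
    then have "0 < C" using Lp_norm_nonneg[of p g] by (auto simp: zero_less_mult_iff)
    then have "C * Lp_norm p g \<le> C * \<Phi> 0 powr (1 - 1 / q)" using norm by simp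
    moreover have "\<Phi> 0 = \<Phi> 0 powr (1 / q) * \<Phi> 0 powr (1 - 1 / q)"
      using \<Phi>0 by (simp flip: powr_add)
    ultimately have "fact n / pi * \<Phi> 0 powr (1 / q) * \<Phi> 0 powr (1 - 1 / q) \<le> C * \<Phi> 0 powr (1 - 1 / q)"
      using le by (metis mult.assoc order_trans)
    then show ?thesis by (rule mult_right_le_imp_le) (use \<Phi>0 in simp)
  qed
  ultimately show ?thesis by (simp add: sharp_constant_def \<Phi>_def)
qed

end

theorem theorem1:
  fixes m n :: nat and p :: ereal
  assumes "1 \<le> n" and "n \<le> 2 * m + 1"
    and "p = (if n = 2 * m + 1 then \<infinity>
              else ereal (2 * (real m + 1) / (2 * real m + 1 - real n)))"
  shows "\<exists>K. sharp_constant n p K \<and>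
    K = fact n / pi *
      (integral {-pi/2..pi/2}
         (\<lambda>\<phi>. \<bar>cos ((real n + 1) * \<phi>)\<bar> powr (2 * (real m + 1) / (real n + 1)) * cos \<phi> ^ (2 * m)))
      powr ((real n + 1) / (2 * (real m + 1))) \<and>
    K = fact n / pi *
      (real (double_fact (2 * m - 1)) / real (double_fact (2 * m))
         * Beta ((real m + 1) / (real n + 1) + 1 / 2) (1 / 2)
       + pi * (real n + 1)
           / (2 powr (2 * real m - 1 + 2 * (real m + 1) / (real n + 1)) * (2 * real m + real n + 3))
         * (\<Sum>j = 1..m div (n + 1).
              real ((2 * m) choose (m - j * (n + 1)))
              / Beta ((real m + 1) / (real n + 1) + real j + 1)
                     ((real m + 1) / (real n + 1) - real j + 1)))
      powr ((real n + 1) / (2 * (real m + 1))) \<and>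
    (m \<le> n \<longrightarrow>
      K = fact n / pi *
        (real (double_fact (2 * m - 1)) / real (double_fact (2 * m))
           * Beta ((real m + 1) / (real n + 1) + 1 / 2) (1 / 2))
        powr ((real n + 1) / (2 * (real m + 1))))"
proof -
  define q where "q = 2 * (real m + 1) / (real n + 1)"
  have q: "real (n + 1) * q = 2 * (real m + 1)" by (simp add: q_def add.commute)
  have pq: "conj_exponent p q"
  proof (cases "n = 2 * m + 1")
    case True
    \<comment> \<open>Here \<open>n + 1 = 2 * (m + 1)\<close>, so that \<open>q = 1\<close>.\<close>
    then show ?thesis using assms(3) by (simp add: conj_exponent_def q_def)
  next
    case False
    define r where "r = 2 * (real m + 1) / (2 * real m + 1 - real n)"
    have "real n < 2 * real m + 1" using assms(2) False by linarith
    then have "1 < r" "1 < q"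
      using assms(1) by (auto simp: r_def q_def field_simps)
    moreover have "1 / r + 1 / q = (2 * real m + 1 - real n + (real n + 1)) / (2 * (real m + 1))"
      by (simp only: r_def q_def divide_divide_eq_right add_divide_distrib[symmetric] mult_1)
    then have "1 / r + 1 / q = 1" by simp
    ultimately show ?thesis using assms(3) False by (auto simp: conj_exponent_def r_def)
  qed
  define K where "K = fact n / pi * phase_integral m (n + 1) q 0 powr (1 / q)"
  have sharp: "sharp_constant n p K"
    unfolding K_def by (rule sharp_constant_phase_integral[OF assms(1) q pq])
  have inv: "1 / q = (real n + 1) / (2 * (real m + 1))" by (simp add: q_def)
  have half: "q / 2 = (real m + 1) / (real n + 1)" by (simp add: q_def field_simps)
  have \<Phi>: "phase_integral m (n + 1) q 0 = integral {-pi/2..pi/2}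
      (\<lambda>\<phi>. \<bar>cos ((real n + 1) * \<phi>)\<bar> powr (2 * (real m + 1) / (real n + 1)) * cos \<phi> ^ (2 * m))"
    by (simp add: phase_integral_def q_def add.commute)
  \<comment> \<open>The factor 2 from folding the cosine expansion lowers the exponent
    \<open>2 * m + q\<close> of 2 by one, and
    \<open>q + 1 = (2 * m + n + 3) / (n + 1)\<close>.\<close>
  have coeff: "2 * pi / (2 ^ (2 * m) * 2 powr q * (q + 1)) = pi * (real n + 1)
      / (2 powr (2 * real m - 1 + 2 * (real m + 1) / (real n + 1)) * (2 * real m + real n + 3))"
  proof -
    have "2 powr (2 * real m - 1 + 2 * (real m + 1) / (real n + 1)) = 2 powr real (2 * m) * 2 powr q / 2"
      unfolding q_def by (simp add: powr_add powr_diff)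
    also have "2 powr real (2 * m) = (2::real) ^ (2 * m)" by (rule powr_realpow) simp
    finally have e: "2 powr (2 * real m - 1 + 2 * (real m + 1) / (real n + 1)) = 2 ^ (2 * m) * 2 powr q / 2" .
    have "q + 1 = (2 * real m + real n + 3) / (real n + 1)" by (simp add: q_def field_simps)
    then show ?thesis unfolding e by (simp add: mult_ac)
  qed
  have \<Phi>': "phase_integral m (n + 1) q 0 =
      real (double_fact (2 * m - 1)) / real (double_fact (2 * m))
         * Beta ((real m + 1) / (real n + 1) + 1 / 2) (1 / 2)
       + pi * (real n + 1)
           / (2 powr (2 * real m - 1 + 2 * (real m + 1) / (real n + 1)) * (2 * real m + real n + 3))
         * (\<Sum>j = 1..m div (n + 1).
              real ((2 * m) choose (m - j * (n + 1)))
              / Beta ((real m + 1) / (real n + 1) + real j + 1)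
                     ((real m + 1) / (real n + 1) - real j + 1))"
    unfolding phase_integral_0_eq[OF zero_less_Suc[of n, unfolded Suc_eq_plus1] q] coeff half ..
  show ?thesis
  proof (intro exI[of _ K] conjI impI)
    show "sharp_constant n p K" by (rule sharp)
  next
    assume "m \<le> n"
    \<comment> \<open>No positive multiple of \<open>n + 1\<close> is at most \<open>m\<close>, so
      the sum is empty.\<close>
    then have "m div (n + 1) = 0" by simp
    then show "K = fact n / pi *
        (real (double_fact (2 * m - 1)) / real (double_fact (2 * m))
           * Beta ((real m + 1) / (real n + 1) + 1 / 2) (1 / 2))
        powr ((real n + 1) / (2 * (real m + 1)))"
      unfolding K_def inv \<Phi>' by simp
  qed (simp_all only: K_def inv \<Phi> flip: \<Phi>')
qed

end
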